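(* Let $d\in\mathbb N$, $d\ge1$. Let $f\in\mathcal S(\mathbb R^{1+2d})$, $S_0\in\mathcal S(\mathbb R^{1+2d};\mathbb R^d)$ and $S_1\in\mathcal S(\mathbb R^{1+2d})$ satisfy $$(\partial_t+v\cdot\nabla_x)f=\nabla_v\cdot S_0+S_1\quad\text{on }\mathbb R^{1+2d}.$$ Let $K_\tau,\ \widetilde K_r,\ \vec K_r,\ \vec K^{\mathrm{pi}}_r$ be the kinetic kernels defined in the context. Then for every $\tau>0$ and every $(t,x,v)\in\mathbb R^{1+2d}$, $$[f-T_{K_\tau}f](t,x,v)=\int_0^\tau\Bigl([T_{\vec K^{\mathrm{pi}}_r}(S_0)](t,x,v)+[T_{\widetilde K_r}(S_1)](t,x,v)+[T_{\vec K_r}(\nabla_v f)](t,x,v)\Bigr)\,\mathrm dr.$$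
   Context: Points of $\mathbb R^{1+2d}$ are written $(t,x,v)$ or $(s,y,w)$ with first entry in $\mathbb R$ and the other two in $\mathbb R^d$; $\mathcal S$ is the Schwartz class; $\mathsf Q=4d+2$. Kinetic group and convolution: $(t,x,v)\circ(s,y,w)=(t+s,\,x+y+sv,\,v+w)$. For $J:\mathbb R^{1+2d}\to\mathbb R^N$ and $g:\mathbb R^{1+2d}\to\mathbb R^N$, $$[T_Jg](t,x,v)=\int_{\mathbb R^{1+2d}}J(s,y,w)\cdot g\bigl((t,x,v)\circ(s,y,w)\bigr)\,\mathrm d(s,y,w)$$ (Euclidean inner product in $\mathbb R^N$; ordinary product if $N=1$). Fix a nonnegative $\psi\in C_c^\infty(\mathbb R^{1+2d})$, $\psi=\psi(m_0,m_1,m_2)$ with $m_0\in\mathbb R$, $m_1,m_2\in\mathbb R^d$, with $\int\psi=1$ and $\operatorname{supp}\psi\subset(-2,-1)\times B_1(0)\times B_1(0)$. For $r>0$ let $g_1(r)=r^3\sin\log r$ and $g_2(r)=r^3\cos\log r$. For $a\in\mathbb R\setminus\{0\}$, $r>0$, let $$\mathcal A_a(r)=\begin{pmatrix} g_1(r) & a\,g_2(r)\\ a^{-1}\frac{\dot g_1(r)}{2r} & \frac{\dot g_2(r)}{2r}\end{pmatrix},\qquad \mathcal F_a(r)=\begin{pmatrix}\frac1a\,\partial_r\frac{\dot g_1(r)}{2r} & \partial_r\frac{\dot g_2(r)}{2r}\end{pmatrix},$$ where every scalar entry is understood as a multiple of the identity of $\mathbb R^d$, so $\mathcal A_a(r)$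 acts on $\mathbb R^{2d}$ (and is invertible) and $\mathcal F_a(r)$ maps $\mathbb R^{2d}$ to $\mathbb R^d$. Write $(\mathcal A_a(r)^{-1})_{i;2}$, $i=1,2$, for the scalar entries of the second column of $\mathcal A_a(r)^{-1}$. For $r>0$ (and likewise with $\tau$ in place of $r$), with $a=s/r^2$ and $b=\mathcal A_{a}(r)^{-1}\binom yw\in\mathbb R^{2d}$, define $$K_r(s,y,w)=2^dr^{-\mathsf Q}\psi(a,b),\qquad \widetilde K_r(s,y,w)=-2^{d+1}s\,r^{-\mathsf Q-1}\psi(a,b),$$ $$\vec K_r(s,y,w)=-2^dr^{-\mathsf Q}\psi(a,b)\,\mathcal F_a(r)b,\qquad \vec K^{\mathrm{pi}}_r(s,y,w)=2^{d+1}s\,r^{-\mathsf Q-1}\sum_{i=1}^2(\mathcal A_a(r)^{-1})_{i;2}\,[\nabla_{m_i}\psi](a,b).$$ All these kernels are understood to be $0$ when $s/r^2\notin(-2,-1)$. The first two are real-valued, the last two $\mathbb R^d$-valued. *)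

theory Defs
  imports "HOL-Analysis.Analysis"
begin

text \<open>Points \<open>(t, x, v)\<close> of $\mathbb R^{1+2d}$, with \<open>d = CARD('d)\<close>.\<close>

type_synonym 'd point = "real \<times> (real ^ 'd) \<times> (real ^ 'd)"


section \<open>Derivatives and Schwartz functions\<close>

text \<open>Only ever evaluated at differentiable functions, where it is the usual directional
  derivative along \<open>u\<close>; for \<open>u \<in> Basis\<close> it is a partial derivative.\<close>

definition dir_deriv :: "'a::real_normed_vector \<Rightarrow> ('a \<Rightarrow> 'b::real_normed_vector) \<Rightarrow> 'a \<Rightarrow> 'b" where
  "dir_deriv u g z = frechet_derivative g (at z) u"

primrec iter_deriv :: "'a list \<Rightarrow> ('a::real_normed_vector \<Rightarrow> 'b::real_normed_vector) \<Rightarrow> 'a \<Rightarrow> 'b" where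
  "iter_deriv [] g = g"
| "iter_deriv (u # us) g = dir_deriv u (iter_deriv us g)"

text \<open>$C^\infty$: every iterated partial derivative is differentiable, hence also continuous.\<close>

definition smooth :: "('a::euclidean_space \<Rightarrow> 'b::real_normed_vector) \<Rightarrow> bool" where
  "smooth g \<longleftrightarrow> (\<forall>us. set us \<subseteq> Basis \<longrightarrow> (\<forall>z. iter_deriv us g differentiable (at z)))"

definition schwartz :: "('a::euclidean_space \<Rightarrow> 'b::real_normed_vector) \<Rightarrow> bool" where
  "schwartz g \<longleftrightarrow> smooth g \<and>
     (\<forall>us (k::nat). set us \<subseteq> Basis \<longrightarrow> (\<exists>C. \<forall>z. norm z ^ k * norm (iter_deriv us g z) \<le> C))"

definition support :: "('a::topological_space \<Rightarrow> 'b::zero) \<Rightarrow> 'a set" where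
  "support g = closure {z. g z \<noteq> 0}"

definition test_function :: "('a::euclidean_space \<Rightarrow> 'b::real_normed_vector) \<Rightarrow> bool" where
  "test_function g \<longleftrightarrow> smooth g \<and> compact (support g)"

definition partial_t :: "('d::finite point \<Rightarrow> real) \<Rightarrow> 'd point \<Rightarrow> real" where
  "partial_t g z = dir_deriv (1, 0, 0) g z"

text \<open>Gradients in the second and third variable; these are also $\nabla_{m_1}$ and $\nabla_{m_2}$.\<close>

definition grad_x :: "('d::finite point \<Rightarrow> real) \<Rightarrow> 'd point \<Rightarrow> real ^ 'd" where
  "grad_x g z = (\<chi> i. dir_deriv (0, axis i 1, 0) g z)"

definition grad_v :: "('d::finite point \<Rightarrow> real) \<Rightarrow> 'd point \<Rightarrow> real ^ 'd" where
  "grad_v g z = (\<chi> i. dir_deriv (0, 0, axis i 1) g z)"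

definition div_v :: "('d::finite point \<Rightarrow> real ^ 'd) \<Rightarrow> 'd point \<Rightarrow> real" where
  "div_v S z = (\<Sum>i\<in>UNIV. dir_deriv (0, 0, axis i 1) (\<lambda>z'. S z' $ i) z)"


section \<open>Kinetic group and convolution\<close>

fun kin_mult :: "'d::finite point \<Rightarrow> 'd point \<Rightarrow> 'd point" where
  "kin_mult (t, x, v) (s, y, w) = (t + s, x + y + s *\<^sub>R v, v + w)"

text \<open>For \<open>'b = real\<close> the inner product is ordinary multiplication.\<close>

definition kin_conv :: "('d::finite point \<Rightarrow> 'b::real_inner) \<Rightarrow> ('d point \<Rightarrow> 'b) \<Rightarrow> 'd point \<Rightarrow> real" where
  "kin_conv J g z = (LINT p|lborel. J p \<bullet> g (kin_mult z p))"

text \<open>The Bochner integral is \<open>0\<close> when the integrand is not integrable, so the existence of the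
  integral is recorded separately.\<close>

definition kin_conv_exists :: "('d::finite point \<Rightarrow> 'b::real_inner) \<Rightarrow> ('d point \<Rightarrow> 'b) \<Rightarrow> 'd point \<Rightarrow> bool" where
  "kin_conv_exists J g z \<longleftrightarrow> integrable lborel (\<lambda>p. J p \<bullet> g (kin_mult z p))"


section \<open>Trajectory matrices\<close>

definition g1 :: "real \<Rightarrow> real" where
  "g1 r = r ^ 3 * sin (ln r)"

definition g2 :: "real \<Rightarrow> real" where
  "g2 r = r ^ 3 * cos (ln r)"

text \<open>The $2 \times 2$ matrix of scalar entries; it acts on $\mathbb R^{2d}$ by \<open>block_act\<close>.\<close>

definition \<A> :: "real \<Rightarrow> real \<Rightarrow> real ^ 2 ^ 2" where
  "\<A> a r = vector [vector [g1 r, a * g2 r],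
                    vector [inverse a * (deriv g1 r / (2 * r)), deriv g2 r / (2 * r)]]"

definition block_act :: "real ^ 2 ^ 2 \<Rightarrow> 'v::real_vector \<times> 'v \<Rightarrow> 'v \<times> 'v" where
  "block_act M b = (M $ 1 $ 1 *\<^sub>R fst b + M $ 1 $ 2 *\<^sub>R snd b,
                    M $ 2 $ 1 *\<^sub>R fst b + M $ 2 $ 2 *\<^sub>R snd b)"

definition \<F> :: "real \<Rightarrow> real \<Rightarrow> 'v::real_vector \<times> 'v \<Rightarrow> 'v" where
  "\<F> a r b = ((1 / a) * deriv (\<lambda>\<rho>. deriv g1 \<rho> / (2 * \<rho>)) r) *\<^sub>R fst b
            + deriv (\<lambda>\<rho>. deriv g2 \<rho> / (2 * \<rho>)) r *\<^sub>R snd b"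

text \<open>The inverse of \<open>block_act (\<A> a r)\<close> is \<open>block_act (matrix_inv (\<A> a r))\<close>.\<close>

lemma block_act_mult: "block_act M (block_act N b) = block_act (M ** N) b"
  by (simp add: block_act_def matrix_matrix_mult_def sum_2 algebra_simps)

lemma block_act_one: "block_act (mat 1) b = b"
  by (simp add: block_act_def mat_def)

lemma deriv_g1: "r > 0 \<Longrightarrow> deriv g1 r = r\<^sup>2 * (3 * sin (ln r) + cos (ln r))"
  unfolding g1_def [abs_def]
  by (rule DERIV_imp_deriv)
    (auto intro!: derivative_eq_intros simp: field_simps power2_eq_square power3_eq_cube)

lemma deriv_g2: "r > 0 \<Longrightarrow> deriv g2 r = r\<^sup>2 * (3 * cos (ln r) - sin (ln r))"
  unfolding g2_def [abs_def]
  by (rule DERIV_imp_deriv)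
    (auto intro!: derivative_eq_intros simp: field_simps power2_eq_square power3_eq_cube)

lemma det_\<A>:
  assumes "a \<noteq> 0" "r > 0"
  shows "det (\<A> a r) = - (r ^ 4 / 2)"
proof -
  define S C where "S = sin (ln r)" and "C = cos (ln r)"
  have SC: "S\<^sup>2 + C\<^sup>2 = 1"
    by (simp add: S_def C_def)
  have g1': "deriv g1 r / (2 * r) = r * (3 * S + C) / 2"
    and g2': "deriv g2 r / (2 * r) = r * (3 * C - S) / 2"
    using assms by (simp_all add: deriv_g1 deriv_g2 S_def C_def power2_eq_square)
  have "det (\<A> a r) = g1 r * (r * (3 * C - S) / 2) - (a * inverse a) * (g2 r * (r * (3 * S + C) / 2))"
    by (simp add: det_2 \<A>_def g1' g2')
  also have "\<dots> = r ^ 3 * S * (r * (3 * C - S) / 2) - r ^ 3 * C * (r * (3 * S + C) / 2)"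
    using assms by (simp add: g1_def g2_def S_def C_def)
  also have "\<dots> = - (r ^ 4 / 2) * (S\<^sup>2 + C\<^sup>2)"
    by (simp add: field_simps power2_eq_square power3_eq_cube power4_eq_xxxx)
  finally show ?thesis by (simp add: SC)
qed

lemma invertible_\<A>: "a \<noteq> 0 \<Longrightarrow> r > 0 \<Longrightarrow> invertible (\<A> a r)"
  by (simp add: invertible_det_nz det_\<A>)


section \<open>Kinetic kernels\<close>

text \<open>The pair \<open>(a, b)\<close> at which the profile \<open>\<psi>\<close> is evaluated.\<close>

fun kin_arg :: "real \<Rightarrow> 'd::finite point \<Rightarrow> 'd point" where
  "kin_arg r (s, y, w) = (s / r\<^sup>2, block_act (matrix_inv (\<A> (s / r\<^sup>2) r)) (y, w))"

definition kin_window :: "real \<Rightarrow> 'd::finite point \<Rightarrow> bool" where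
  "kin_window r p \<longleftrightarrow> fst p / r\<^sup>2 \<in> {-2<..<-1}"

text \<open>The homogeneous dimension $\mathsf Q = 4d + 2$.\<close>

definition hom_dim :: "'d::finite itself \<Rightarrow> nat" where
  "hom_dim _ = 4 * CARD('d) + 2"

context
  fixes \<psi> :: "'d::finite point \<Rightarrow> real"
begin

definition K :: "real \<Rightarrow> 'd point \<Rightarrow> real" where
  "K r p = (if kin_window r p then 2 ^ CARD('d) / r ^ hom_dim TYPE('d) * \<psi> (kin_arg r p) else 0)"

definition K_tilde :: "real \<Rightarrow> 'd point \<Rightarrow> real" where
  "K_tilde r p = (if kin_window r p
     then - (2 ^ (CARD('d) + 1)) * fst p / r ^ (hom_dim TYPE('d) + 1) * \<psi> (kin_arg r p) else 0)"

definition K_vec :: "real \<Rightarrow> 'd point \<Rightarrow> real ^ 'd" where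
  "K_vec r p = (if kin_window r p
     then (- (2 ^ CARD('d)) / r ^ hom_dim TYPE('d) * \<psi> (kin_arg r p)) *\<^sub>R
            \<F> (fst (kin_arg r p)) r (snd (kin_arg r p)) else 0)"

definition K_pi :: "real \<Rightarrow> 'd point \<Rightarrow> real ^ 'd" where
  "K_pi r p = (if kin_window r p
     then (2 ^ (CARD('d) + 1) * fst p / r ^ (hom_dim TYPE('d) + 1)) *\<^sub>R
            (matrix_inv (\<A> (fst (kin_arg r p)) r) $ 1 $ 2 *\<^sub>R grad_x \<psi> (kin_arg r p) +
             matrix_inv (\<A> (fst (kin_arg r p)) r) $ 2 $ 2 *\<^sub>R grad_v \<psi> (kin_arg r p))
     else 0)"

end

end

theory Submission
  imports Defs
begin

text \<open>For fixed \<open>m = (a, b1, b2)\<close> the curve \<open>r \<mapsto> traj r m\<close>, given by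
\<open>(r\<^sup>2 a, \<A> a r (b1, b2))\<close>, starts at the origin, and left translation by \<open>z\<close> gives a curve from \<open>z\<close>
along which position changes at \<open>2 r a\<close> times the velocity. This is what the
choice of the second row of \<open>\<A>\<close> achieves, namely the derivative of the first row divided by \<open>2 r a\<close>.
By the chain rule and the equation for \<open>f\<close>, the derivative of \<open>f\<close> along the curve is
\<open>2 r a (div_v S0 + S1) + \<F> b \<bullet> grad_v f\<close>, called \<open>rate\<close> below (\<open>f_along_traj\<close>).
Integrating it over \<open>0 < r < \<tau>\<close> and then against \<open>\<psi> m\<close>, which has mass one, expresses
the \<open>\<psi>\<close>-average of \<open>f\<close> at the end points minus \<open>f z\<close>, which up to the sign built into the kernels is
the claim (\<open>representation_formula\<close>).

Two facts turn this into the statement about kernels. First, \<open>traj r\<close> is a change of variables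
with constant Jacobian \<open>r ^ (4 d + 2) / 2 ^ d\<close> (\<open>distr_traj\<close>), so each kernel is the density
of the image under \<open>traj r\<close> of a profile \<open>j\<close> living on the support of \<open>\<psi>\<close>, and convolution with it is
the integral of \<open>j m \<bullet> g (kin_mult z (traj r m))\<close> (\<open>kin_conv_pushed\<close>).
Second, the divergence of \<open>S0\<close> is moved onto the kernel by parts (\<open>kin_conv_K_pi\<close>). In the
variables \<open>(s, y, w)\<close> a derivative in \<open>w\<close> is a derivative in a fixed direction on which the group
product acts by a plain shift, and \<open>- K_pi\<close> is the \<open>w\<close>-gradient of \<open>K_tilde\<close>.

Since \<open>\<psi>\<close> has bounded support away from \<open>a = 0\<close>, and since \<open>\<F>\<close> stays bounded as
\<open>r\<close> tends to \<open>0\<close>, the function \<open>rate\<close> is bounded where \<open>\<psi>\<close> lives; together with bounds for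
\<open>\<psi>\<close> and its gradients this gives the integrability claims and justifies Fubini's theorem.\<close>

section \<open>The trajectory matrices\<close>

text \<open>The functions \<open>h1\<close> and \<open>h2\<close> are \<open>deriv g1 r / (2 r)\<close> and \<open>deriv g2 r / (2 r)\<close> for positive \<open>r\<close>.
The closed forms are smooth there and vanish at \<open>r = 0\<close>.\<close>

definition h1 :: "real \<Rightarrow> real" where
  "h1 r = r * (3 * sin (ln r) + cos (ln r)) / 2"

definition h2 :: "real \<Rightarrow> real" where
  "h2 r = r * (3 * cos (ln r) - sin (ln r)) / 2"

lemma deriv_g1_half: "r > 0 \<Longrightarrow> deriv g1 r / (2 * r) = h1 r"
  by (simp add: deriv_g1 h1_def power2_eq_square)

lemma deriv_g2_half: "r > 0 \<Longrightarrow> deriv g2 r / (2 * r) = h2 r"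
  by (simp add: deriv_g2 h2_def power2_eq_square)

lemma g1_has_derivative: "r > 0 \<Longrightarrow> (g1 has_real_derivative 2 * r * h1 r) (at r)"
  unfolding g1_def [abs_def] h1_def
  by (auto intro!: derivative_eq_intros simp: field_simps power2_eq_square power3_eq_cube)

lemma g2_has_derivative: "r > 0 \<Longrightarrow> (g2 has_real_derivative 2 * r * h2 r) (at r)"
  unfolding g2_def [abs_def] h2_def
  by (auto intro!: derivative_eq_intros simp: field_simps power2_eq_square power3_eq_cube)

lemma h1_has_derivative:
  "r > 0 \<Longrightarrow> (h1 has_real_derivative sin (ln r) + 2 * cos (ln r)) (at r)"
  unfolding h1_def [abs_def]
  by (auto intro!: derivative_eq_intros simp: field_simps)

lemma h2_has_derivative:
  "r > 0 \<Longrightarrow> (h2 has_real_derivative cos (ln r) - 2 * sin (ln r)) (at r)"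
  unfolding h2_def [abs_def]
  by (auto intro!: derivative_eq_intros simp: field_simps)

text \<open>The derivatives of \<open>h1\<close> and \<open>h2\<close> are bounded functions of \<open>ln r\<close>: the power \<open>r\<^sup>3\<close> in
\<open>g1\<close> and \<open>g2\<close> loses one factor \<open>r\<close> in each of the two differentiations and one in the division by \<open>2 r\<close>.
Hence \<open>\<F>\<close> does not blow up at \<open>r = 0\<close>.\<close>

lemma \<F>_eq:
  assumes "r > 0"
  shows "\<F> a r b = ((sin (ln r) + 2 * cos (ln r)) / a) *\<^sub>R fst b
                  + (cos (ln r) - 2 * sin (ln r)) *\<^sub>R snd b"
proof -
  have "deriv (\<lambda>\<rho>. deriv g1 \<rho> / (2 * \<rho>)) r = sin (ln r) + 2 * cos (ln r)"
    by (rule DERIV_imp_deriv, rule has_field_derivative_transform_within_open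
        [OF h1_has_derivative[OF assms], of "{0<..}"]) (use assms in \<open>auto simp: deriv_g1_half\<close>)
  moreover have "deriv (\<lambda>\<rho>. deriv g2 \<rho> / (2 * \<rho>)) r = cos (ln r) - 2 * sin (ln r)"
    by (rule DERIV_imp_deriv, rule has_field_derivative_transform_within_open
        [OF h2_has_derivative[OF assms], of "{0<..}"]) (use assms in \<open>auto simp: deriv_g2_half\<close>)
  ultimately show ?thesis by (simp add: \<F>_def)
qed

lemma \<A>_eq: "r > 0 \<Longrightarrow>
    \<A> a r = vector [vector [g1 r, a * g2 r], vector [h1 r / a, h2 r]]"
  by (simp add: \<A>_def deriv_g1_half deriv_g2_half divide_inverse_commute [of "h1 r" a])

text \<open>The determinant is half the Wronskian of \<open>g1\<close> and \<open>g2\<close> divided by \<open>r\<close>. The sine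
and cosine of the logarithm never vanish together, and their squares add up so that no oscillation is left.\<close>

lemma trajectory_det: "g1 r * h2 r - g2 r * h1 r = - (r ^ 4 / 2)"
proof -
  have "g1 r * h2 r - g2 r * h1 r = - (r ^ 4 / 2) * ((sin (ln r))\<^sup>2 + (cos (ln r))\<^sup>2)"
    unfolding g1_def g2_def h1_def h2_def power2_eq_square power3_eq_cube power4_eq_xxxx
    by (simp del: sin_cos_squared_add3 add: field_simps)
  then show ?thesis by simp
qed

lemma matrix_inv_\<A>_left:
  assumes "a \<noteq> 0" "r > 0"
  shows "matrix_inv (\<A> a r) ** \<A> a r = mat 1"
  using someI_ex[OF invertible_\<A>[OF assms, unfolded invertible_def]]
  by (simp add: matrix_inv_def)

lemma matrix_inv_\<A>:
  assumes "a \<noteq> 0" "r > 0"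
  shows "matrix_inv (\<A> a r) =
    vector [vector [- 2 * h2 r / r ^ 4, 2 * a * g2 r / r ^ 4],
            vector [2 * h1 r / (a * r ^ 4), - 2 * g1 r / r ^ 4]]" (is "_ = ?B")
proof -
  have *: "g2 r * h1 r * 2 = r ^ 4 + g1 r * h2 r * 2" using trajectory_det[of r] by simp
  have AB: "\<A> a r ** ?B = mat 1"
    using assms * unfolding \<A>_eq[OF assms(2)]
    by (simp add: vec_eq_iff forall_2 matrix_matrix_mult_def sum_2 mat_def field_simps)
  have "matrix_inv (\<A> a r) = matrix_inv (\<A> a r) ** (\<A> a r ** ?B)"
    unfolding AB by simp
  also have "\<dots> = ?B"
    unfolding matrix_mul_assoc matrix_inv_\<A>_left[OF assms] by simp
  finally show ?thesis .
qed

section \<open>Linear changes of variables on product spaces\<close>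

lemma borel_measurable_fst_comp [measurable (raw)]:
  fixes f :: "'a \<Rightarrow> 'u::topological_space \<times> 'v::topological_space"
  assumes "f \<in> borel_measurable M"
  shows "(\<lambda>x. fst (f x)) \<in> borel_measurable M"
  by (rule measurable_compose[OF assms borel_measurable_continuous_onI]) (intro continuous_intros)

lemma borel_measurable_snd_comp [measurable (raw)]:
  fixes f :: "'a \<Rightarrow> 'u::topological_space \<times> 'v::topological_space"
  assumes "f \<in> borel_measurable M"
  shows "(\<lambda>x. snd (f x)) \<in> borel_measurable M"
  by (rule measurable_compose[OF assms borel_measurable_continuous_onI]) (intro continuous_intros)

lemma nn_integral_lborel_affine:
  fixes H :: "'v::euclidean_space \<Rightarrow> ennreal"
  assumes [measurable]: "H \<in> borel_measurable borel" and "c \<noteq> 0"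
  shows "ennreal (\<bar>c\<bar> ^ DIM('v)) * (\<integral>\<^sup>+x. H (t + c *\<^sub>R x) \<partial>lborel) = (\<integral>\<^sup>+x. H x \<partial>lborel)"
proof -
  have "(\<integral>\<^sup>+x. H x \<partial>lborel)
      = (\<integral>\<^sup>+x. H x \<partial>density (distr lborel borel (\<lambda>x. t + c *\<^sub>R x)) (\<lambda>_. ennreal (\<bar>c\<bar> ^ DIM('v))))"
    by (subst lborel_affine[OF assms(2), of t]) (simp add: ennreal_power)
  also have "\<dots> = ennreal (\<bar>c\<bar> ^ DIM('v)) * (\<integral>\<^sup>+x. H (t + c *\<^sub>R x) \<partial>lborel)"
    by (simp add: nn_integral_density nn_integral_distr nn_integral_cmult)
  finally show ?thesis ..
qed

lemma nn_integral_lborel_fst: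
  fixes H :: "'u::euclidean_space \<times> 'v::euclidean_space \<Rightarrow> ennreal"
  assumes "H \<in> borel_measurable borel"
  shows "(\<integral>\<^sup>+p. H p \<partial>lborel) = (\<integral>\<^sup>+x. \<integral>\<^sup>+y. H (x, y) \<partial>lborel \<partial>lborel)"
proof -
  have "H \<in> borel_measurable (lborel \<Otimes>\<^sub>M lborel)"
    using assms by (simp add: lborel_prod)
  from lborel.nn_integral_fst[OF this] show ?thesis by (simp add: lborel_prod)
qed

lemma nn_integral_lborel_snd:
  fixes H :: "'u::euclidean_space \<times> 'v::euclidean_space \<Rightarrow> ennreal"
  assumes "H \<in> borel_measurable borel"
  shows "(\<integral>\<^sup>+p. H p \<partial>lborel) = (\<integral>\<^sup>+y. \<integral>\<^sup>+x. H (x, y) \<partial>lborel \<partial>lborel)"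
proof -
  have "(\<lambda>(x, y). H (x, y)) \<in> borel_measurable (lborel \<Otimes>\<^sub>M lborel)"
    using assms by (simp add: lborel_prod)
  from lborel_pair.nn_integral_snd[OF this] show ?thesis by (simp add: lborel_prod)
qed

text \<open>A block-scalar map is a composition of shears and scalings in one block at a time, so Tonelli's
theorem and affine substitution suffice. The case \<open>\<alpha> = 0\<close> needs its own order of substitution and does
occur: \<open>g1 r\<close> vanishes whenever \<open>ln r\<close> is a multiple of \<open>\<pi>\<close>.\<close>

lemma nn_integral_block_linear:
  fixes H :: "'v::euclidean_space \<times> 'v \<Rightarrow> ennreal"
  assumes [measurable]: "H \<in> borel_measurable borel"
    and det: "\<alpha> * \<delta> - \<beta> * \<gamma> \<noteq> 0"
  shows "ennreal (\<bar>\<alpha> * \<delta> - \<beta> * \<gamma>\<bar> ^ DIM('v)) *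
      (\<integral>\<^sup>+p. H (\<alpha> *\<^sub>R fst p + \<beta> *\<^sub>R snd p, \<gamma> *\<^sub>R fst p + \<delta> *\<^sub>R snd p) \<partial>lborel)
    = (\<integral>\<^sup>+p. H p \<partial>lborel)"
proof -
  let ?n = "DIM('v)"
  let ?I = "\<integral>\<^sup>+p. H (\<alpha> *\<^sub>R fst p + \<beta> *\<^sub>R snd p, \<gamma> *\<^sub>R fst p + \<delta> *\<^sub>R snd p) \<partial>lborel"
  have I: "?I = (\<integral>\<^sup>+y. \<integral>\<^sup>+x. H (\<alpha> *\<^sub>R x + \<beta> *\<^sub>R y, \<gamma> *\<^sub>R x + \<delta> *\<^sub>R y) \<partial>lborel \<partial>lborel)"
    by (subst nn_integral_lborel_snd)
      (auto intro!: measurable_compose[OF borel_measurable_Pair assms(1)])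
  show ?thesis
  proof (cases "\<alpha> = 0")
    case False
    define \<kappa> where "\<kappa> = (\<alpha> * \<delta> - \<beta> * \<gamma>) / \<alpha>"
    have \<kappa>: "\<kappa> \<noteq> 0" "\<alpha> * \<kappa> = \<alpha> * \<delta> - \<beta> * \<gamma>" 
      using det False by (auto simp: \<kappa>_def)
    \<comment> \<open>Substituting \<open>x' = \<alpha> x + \<beta> y\<close> turns the second block into \<open>(\<gamma> / \<alpha>) x' + \<kappa> y\<close>.\<close>
    have \<delta>: "\<gamma> / \<alpha> * \<beta> + \<kappa> = \<delta>"
      using False by (simp add: \<kappa>_def field_simps)
    have 1: "ennreal (\<bar>\<alpha>\<bar> ^ ?n) * (\<integral>\<^sup>+x. H (\<alpha> *\<^sub>R x + \<beta> *\<^sub>R y, \<gamma> *\<^sub>R x + \<delta> *\<^sub>R y) \<partial>lborel)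
        = (\<integral>\<^sup>+x. H (x, (\<gamma> / \<alpha>) *\<^sub>R x + \<kappa> *\<^sub>R y) \<partial>lborel)" for y
      using nn_integral_lborel_affine[of "\<lambda>x. H (x, (\<gamma> / \<alpha>) *\<^sub>R x + \<kappa> *\<^sub>R y)" \<alpha> "\<beta> *\<^sub>R y"] False
      unfolding \<delta>[symmetric] by (simp add: algebra_simps)
    have 2: "ennreal (\<bar>\<kappa>\<bar> ^ ?n) * (\<integral>\<^sup>+y. H (x, (\<gamma> / \<alpha>) *\<^sub>R x + \<kappa> *\<^sub>R y) \<partial>lborel)
        = (\<integral>\<^sup>+y. H (x, y) \<partial>lborel)" for x
      using nn_integral_lborel_affine[of "\<lambda>y. H (x, y)" \<kappa> "(\<gamma> / \<alpha>) *\<^sub>R x"] \<kappa>(1) by simp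
    have "ennreal (\<bar>\<alpha>\<bar> ^ ?n) * ?I = (\<integral>\<^sup>+y. \<integral>\<^sup>+x. H (x, (\<gamma> / \<alpha>) *\<^sub>R x + \<kappa> *\<^sub>R y) \<partial>lborel \<partial>lborel)"
      unfolding I 1[symmetric] by (rule nn_integral_cmult[symmetric]) measurable
    also have "\<dots> = (\<integral>\<^sup>+p. H (fst p, (\<gamma> / \<alpha>) *\<^sub>R fst p + \<kappa> *\<^sub>R snd p) \<partial>lborel)"
      by (subst nn_integral_lborel_snd) auto
    also have "\<dots> = (\<integral>\<^sup>+x. \<integral>\<^sup>+y. H (x, (\<gamma> / \<alpha>) *\<^sub>R x + \<kappa> *\<^sub>R y) \<partial>lborel \<partial>lborel)"
      by (subst nn_integral_lborel_fst) auto
    finally have "ennreal (\<bar>\<kappa>\<bar> ^ ?n) * (ennreal (\<bar>\<alpha>\<bar> ^ ?n) * ?I)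
       = (\<integral>\<^sup>+x. \<integral>\<^sup>+y. H (x, y) \<partial>lborel \<partial>lborel)"
      unfolding 2[symmetric] by (simp add: nn_integral_cmult)
    moreover have "ennreal (\<bar>\<kappa>\<bar> ^ ?n) * ennreal (\<bar>\<alpha>\<bar> ^ ?n) = ennreal (\<bar>\<alpha> * \<delta> - \<beta> * \<gamma>\<bar> ^ ?n)"
      unfolding \<kappa>(2)[symmetric]
      by (subst ennreal_mult[symmetric]) (auto simp: abs_mult power_mult_distrib mult.commute)
    ultimately show ?thesis
      by (simp add: nn_integral_lborel_fst mult.assoc[symmetric])
  next
    case True
    then have nz: "\<beta> \<noteq> 0" "\<gamma> \<noteq> 0" using det by auto
    have 1: "ennreal (\<bar>\<gamma>\<bar> ^ ?n) * (\<integral>\<^sup>+x. H (\<beta> *\<^sub>R y, \<gamma> *\<^sub>R x + \<delta> *\<^sub>R y) \<partial>lborel)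
        = (\<integral>\<^sup>+x. H (\<beta> *\<^sub>R y, x) \<partial>lborel)" for y
      using nn_integral_lborel_affine[of "\<lambda>x. H (\<beta> *\<^sub>R y, x)" \<gamma> "\<delta> *\<^sub>R y"] nz
      by (simp add: add.commute)
    have 2: "ennreal (\<bar>\<beta>\<bar> ^ ?n) * (\<integral>\<^sup>+y. \<integral>\<^sup>+x. H (\<beta> *\<^sub>R y, x) \<partial>lborel \<partial>lborel)
        = (\<integral>\<^sup>+y. \<integral>\<^sup>+x. H (y, x) \<partial>lborel \<partial>lborel)"
      using nn_integral_lborel_affine[of "\<lambda>y. \<integral>\<^sup>+x. H (y, x) \<partial>lborel" \<beta> 0] nz by simp
    have "ennreal (\<bar>\<gamma>\<bar> ^ ?n) * ?I = (\<integral>\<^sup>+y. \<integral>\<^sup>+x. H (\<beta> *\<^sub>R y, x) \<partial>lborel \<partial>lborel)"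
      unfolding I 1[symmetric] using True by (subst nn_integral_cmult[symmetric]) simp_all
    then have "ennreal (\<bar>\<beta>\<bar> ^ ?n) * (ennreal (\<bar>\<gamma>\<bar> ^ ?n) * ?I)
       = (\<integral>\<^sup>+x. \<integral>\<^sup>+y. H (x, y) \<partial>lborel \<partial>lborel)"
      using 2 by simp
    moreover have "ennreal (\<bar>\<beta>\<bar> ^ ?n) * ennreal (\<bar>\<gamma>\<bar> ^ ?n) = ennreal (\<bar>\<alpha> * \<delta> - \<beta> * \<gamma>\<bar> ^ ?n)"
      using True by (subst ennreal_mult[symmetric]) (auto simp: abs_mult power_mult_distrib)
    ultimately show ?thesis
      by (simp add: nn_integral_lborel_fst mult.assoc[symmetric])
  qed
qed

section \<open>The trajectory map and its Jacobian\<close>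

text \<open>The map \<open>m \<mapsto> (r\<^sup>2 a, \<A> a r b)\<close> for \<open>m = (a, b)\<close>, written with \<open>h1\<close> and \<open>h2\<close> so that it is Borel
jointly in \<open>r\<close> and \<open>m\<close> and sends everything to the origin at \<open>r = 0\<close>. The division by zero at
\<open>a = 0\<close> concerns a null set only.\<close>

definition traj :: "real \<Rightarrow> 'd::finite point \<Rightarrow> 'd point" where
  "traj r m = (r\<^sup>2 * fst m,
     g1 r *\<^sub>R fst (snd m) + (fst m * g2 r) *\<^sub>R snd (snd m),
     (h1 r / fst m) *\<^sub>R fst (snd m) + h2 r *\<^sub>R snd (snd m))"

lemma g1_measurable [measurable]: "g1 \<in> borel_measurable borel"
  unfolding g1_def [abs_def] by measurable

lemma g2_measurable [measurable]: "g2 \<in> borel_measurable borel"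
  unfolding g2_def [abs_def] by measurable

lemma h1_measurable [measurable]: "h1 \<in> borel_measurable borel"
  unfolding h1_def [abs_def] by measurable

lemma h2_measurable [measurable]: "h2 \<in> borel_measurable borel"
  unfolding h2_def [abs_def] by measurable

lemma traj_measurable [measurable]:
  assumes [measurable]: "R \<in> borel_measurable M" "m \<in> borel_measurable M"
  shows "(\<lambda>x. traj (R x) (m x)) \<in> borel_measurable M"
  unfolding traj_def [abs_def] by (intro borel_measurable_Pair) measurable

text \<open>For fixed \<open>a \<noteq> 0\<close> the map in \<open>b\<close> is block-linear with determinant \<open>- (r ^ 4 / 2)\<close>, independent
of \<open>a\<close>, and time is scaled by \<open>r\<^sup>2\<close>. This gives the Jacobian \<open>r\<^sup>2 (r ^ 4 / 2) ^ d\<close>.\<close>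

lemma nn_integral_traj:
  fixes H :: "'d::finite point \<Rightarrow> ennreal"
  assumes [measurable]: "H \<in> borel_measurable borel" and r: "r > 0"
  shows "(\<integral>\<^sup>+m. H (traj r m) \<partial>lborel)
    = ennreal (2 ^ CARD('d) / r ^ hom_dim TYPE('d)) * (\<integral>\<^sup>+p. H p \<partial>lborel)"
proof -
  let ?n = "CARD('d)"
  have inner: "ennreal ((r ^ 4 / 2) ^ ?n) * (\<integral>\<^sup>+b. H (traj r (a, b)) \<partial>lborel)
      = (\<integral>\<^sup>+b. H (r\<^sup>2 * a, b) \<partial>lborel)" if "a \<noteq> 0" for a
  proof -
    have det: "g1 r * h2 r - (a * g2 r) * (h1 r / a) = - (r ^ 4 / 2)"
      using trajectory_det[of r] that by simp
    show ?thesis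
      using nn_integral_block_linear[of "\<lambda>b. H (r\<^sup>2 * a, b)" "g1 r" "h2 r" "a * g2 r" "h1 r / a"] r
      unfolding det by (simp add: traj_def)
  qed
  have "ennreal (r\<^sup>2) * (ennreal ((r ^ 4 / 2) ^ ?n) * (\<integral>\<^sup>+m. H (traj r m) \<partial>lborel))
      = ennreal (r\<^sup>2) * (\<integral>\<^sup>+a. ennreal ((r ^ 4 / 2) ^ ?n) * (\<integral>\<^sup>+b. H (traj r (a, b)) \<partial>lborel) \<partial>lborel)"
    by (subst nn_integral_lborel_fst) (simp_all add: nn_integral_cmult)
  also have "(\<integral>\<^sup>+a. ennreal ((r ^ 4 / 2) ^ ?n) * (\<integral>\<^sup>+b. H (traj r (a, b)) \<partial>lborel) \<partial>lborel)
      = (\<integral>\<^sup>+a. (\<integral>\<^sup>+b. H (r\<^sup>2 * a, b) \<partial>lborel) \<partial>lborel)"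
    by (rule nn_integral_cong_AE, rule eventually_mono[OF AE_lborel_singleton[of 0]])
       (rule inner)
  also have "ennreal (r\<^sup>2) * \<dots> = (\<integral>\<^sup>+a. (\<integral>\<^sup>+b. H (a, b) \<partial>lborel) \<partial>lborel)"
    using nn_integral_lborel_affine[of "\<lambda>a. \<integral>\<^sup>+b. H (a, b) \<partial>lborel" "r\<^sup>2" 0] r by simp
  also have "\<dots> = (\<integral>\<^sup>+p. H p \<partial>lborel)" by (simp add: nn_integral_lborel_fst)
  finally have eq: "ennreal (r\<^sup>2) * (ennreal ((r ^ 4 / 2) ^ ?n) * (\<integral>\<^sup>+m. H (traj r m) \<partial>lborel))
      = (\<integral>\<^sup>+p. H p \<partial>lborel)" .
  have one: "2 ^ ?n / r ^ hom_dim TYPE('d) * (r\<^sup>2 * (r ^ 4 / 2) ^ ?n) = 1"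
  proof -
    have "r ^ hom_dim TYPE('d) = r\<^sup>2 * (r ^ 4) ^ ?n"
      unfolding hom_dim_def power_add power_mult by (rule mult.commute)
    then show ?thesis using r by (simp add: power_divide)
  qed
  have split: "ennreal (x * (y * z)) = ennreal x * (ennreal y * ennreal z)"
    if "x \<ge> 0" "y \<ge> 0" "z \<ge> 0" for x y z
    using that by (simp add: ennreal_mult)
  have "(\<integral>\<^sup>+m. H (traj r m) \<partial>lborel)
      = ennreal (2 ^ ?n / r ^ hom_dim TYPE('d) * (r\<^sup>2 * (r ^ 4 / 2) ^ ?n)) * (\<integral>\<^sup>+m. H (traj r m) \<partial>lborel)"
    unfolding one by simp
  also have "\<dots> = ennreal (2 ^ ?n / r ^ hom_dim TYPE('d)) *
     (ennreal (r\<^sup>2) * (ennreal ((r ^ 4 / 2) ^ ?n) * (\<integral>\<^sup>+m. H (traj r m) \<partial>lborel)))"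
    using r by (subst split) (simp_all only: mult.assoc, simp_all)
  finally show ?thesis unfolding eq .
qed

text \<open>As an equality of measures the change of variables also transfers to Bochner integrals, with
their integrability.\<close>

lemma distr_traj:
  assumes r: "r > 0"
  shows "distr lborel borel (traj r :: 'd::finite point \<Rightarrow> _)
    = density lborel (\<lambda>_. ennreal (2 ^ CARD('d) / r ^ hom_dim TYPE('d)))"
proof (rule measure_eqI)
  fix A :: "'d point set" assume "A \<in> sets (distr lborel borel (traj r))"
  then have A [measurable]: "A \<in> sets borel" by simp
  have "emeasure (distr lborel borel (traj r)) A = (\<integral>\<^sup>+p. indicator A p \<partial>distr lborel borel (traj r))"
    by simp
  also have "\<dots> = (\<integral>\<^sup>+m. indicator A (traj r m) \<partial>lborel)"
    by (rule nn_integral_distr) auto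
  also have "\<dots> = ennreal (2 ^ CARD('d) / r ^ hom_dim TYPE('d)) * (\<integral>\<^sup>+p. indicator A p \<partial>lborel)"
    by (rule nn_integral_traj[OF _ r]) auto
  also have "\<dots> = emeasure (density lborel (\<lambda>_. ennreal (2 ^ CARD('d) / r ^ hom_dim TYPE('d)))) A"
    by (simp add: emeasure_density nn_integral_cmult)
  finally show "emeasure (distr lborel borel (traj r)) A = \<dots>" .
qed simp

lemma
  fixes H :: "'d::finite point \<Rightarrow> 'b::{banach, second_countable_topology}"
  assumes [measurable]: "H \<in> borel_measurable borel" and r: "r > 0"
  shows integrable_traj: "integrable lborel (\<lambda>p. (2 ^ CARD('d) / r ^ hom_dim TYPE('d)) *\<^sub>R H p)
      \<longleftrightarrow> integrable lborel (\<lambda>m. H (traj r m))"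
    and integral_traj: "(LINT p|lborel. (2 ^ CARD('d) / r ^ hom_dim TYPE('d)) *\<^sub>R H p)
      = (LINT m|lborel. H (traj r m))"
proof -
  have "integrable lborel (\<lambda>m. H (traj r m)) \<longleftrightarrow> integrable (distr lborel borel (traj r)) H"
    by (rule integrable_distr_eq[symmetric]) auto
  also have "\<dots> \<longleftrightarrow> integrable lborel (\<lambda>p. (2 ^ CARD('d) / r ^ hom_dim TYPE('d)) *\<^sub>R H p)"
    unfolding distr_traj[OF r] using r by (subst integrable_density) auto
  finally show "integrable lborel (\<lambda>p. (2 ^ CARD('d) / r ^ hom_dim TYPE('d)) *\<^sub>R H p)
      \<longleftrightarrow> integrable lborel (\<lambda>m. H (traj r m))" ..
  have "(LINT m|lborel. H (traj r m)) = (LINT p|distr lborel borel (traj r). H p)"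
    by (rule integral_distr[symmetric]) auto
  also have "\<dots> = (LINT p|lborel. (2 ^ CARD('d) / r ^ hom_dim TYPE('d)) *\<^sub>R H p)"
    unfolding distr_traj[OF r] using r by (subst integral_density) auto
  finally show "(LINT p|lborel. (2 ^ CARD('d) / r ^ hom_dim TYPE('d)) *\<^sub>R H p)
      = (LINT m|lborel. H (traj r m))" ..
qed

section \<open>Bounds and integration by parts along a line\<close>

lemma smooth_differentiable: "smooth g \<Longrightarrow> g differentiable (at z)"
  unfolding smooth_def by (metis empty_set empty_subsetI iter_deriv.simps(1))

lemma smooth_dir_deriv_differentiable:
  assumes "smooth g" "u \<in> Basis"
  shows "dir_deriv u g differentiable (at z)"
proof -
  have "iter_deriv [u] g differentiable (at z)"
    using assms unfolding smooth_def by (metis empty_set empty_subsetI insert_subset list.set(2))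
  moreover have "iter_deriv [u] g = dir_deriv u g" by (simp add: fun_eq_iff)
  ultimately show ?thesis by simp
qed

lemma differentiable_borel:
  fixes g :: "'a::euclidean_space \<Rightarrow> 'b::euclidean_space"
  assumes "\<And>z. g differentiable (at z)"
  shows "continuous_on UNIV g" "g \<in> borel_measurable borel"
proof -
  show "continuous_on UNIV g"
    using assms by (simp add: continuous_on_eq_continuous_at differentiable_imp_continuous_within)
  then show "g \<in> borel_measurable borel" by (rule borel_measurable_continuous_onI)
qed

lemma schwartz_bounded:
  assumes "schwartz g"
  obtains C where "\<And>z. norm (g z) \<le> C"
proof -
  have "\<exists>C. \<forall>z. norm z ^ 0 * norm (iter_deriv [] g z) \<le> C"
    using assms[unfolded schwartz_def, THEN conjunct2, THEN spec[of _ "[]"], THEN spec[of _ 0]]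
    by (simp del: power_0)
  then obtain C where "\<forall>z. norm (g z) \<le> C" by auto
  then show ?thesis using that[of C] by blast
qed

lemma schwartz_dir_deriv_bounded:
  assumes "schwartz g" "u \<in> Basis"
  obtains C where "\<And>z. norm (dir_deriv u g z) \<le> C"
proof -
  have "\<exists>C. \<forall>z. norm z ^ 0 * norm (iter_deriv [u] g z) \<le> C"
    using assms(1)[unfolded schwartz_def, THEN conjunct2, THEN spec[of _ "[u]"], THEN spec[of _ 0]]
      assms(2) by simp
  then obtain C where "\<forall>z. norm (dir_deriv u g z) \<le> C" by auto
  then show ?thesis using that[of C] by blast
qed

lemma not_in_support: "z \<notin> support g \<Longrightarrow> g z = 0"
  using closure_subset[of "{z. g z \<noteq> 0}"] unfolding support_def by blast

lemma dir_deriv_outside_support: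
  fixes g :: "'a::real_normed_vector \<Rightarrow> 'b::real_normed_vector"
  assumes "z \<notin> support g"
  shows "dir_deriv u g z = 0"
proof -
  have "((\<lambda>_. 0) has_derivative (\<lambda>_. 0)) (at z)" by (rule has_derivative_const)
  then have "(g has_derivative (\<lambda>_. 0)) (at z)"
    by (rule has_derivative_transform_within_open[of _ _ _ _ "- support g"])
      (use assms in \<open>auto simp: not_in_support, simp add: support_def open_Compl\<close>)
  then show ?thesis
    by (simp add: dir_deriv_def frechet_derivative_at[symmetric])
qed

lemma bounded_of_compact_support:
  fixes g :: "'a::euclidean_space \<Rightarrow> 'b::euclidean_space"
  assumes "continuous_on UNIV g" "compact S" "\<And>z. z \<notin> S \<Longrightarrow> g z = 0"
  obtains C where "\<And>z. norm (g z) \<le> C"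
proof -
  have "bounded (g ` S)"
    by (rule compact_imp_bounded[OF compact_continuous_image])
      (use assms in \<open>auto intro: continuous_on_subset\<close>)
  then obtain C where "C > 0" "\<And>y. y \<in> g ` S \<Longrightarrow> norm y \<le> C" by (auto simp: bounded_pos)
  then have "norm (g z) \<le> C" for z by (cases "z \<in> S") (auto simp: assms(3))
  then show ?thesis by (rule that)
qed

lemma
  fixes G :: "'a::euclidean_space \<Rightarrow> 'b::{banach, second_countable_topology}"
  assumes "integrable lborel G"
  shows integrable_translate: "integrable lborel (\<lambda>p. G (p + c))"
    and integral_translate: "(LINT p|lborel. G (p + c)) = (LINT p|lborel. G p)"
proof -
  have [measurable]: "G \<in> borel_measurable borel" using assms by auto
  have *: "lborel = distr lborel borel (\<lambda>p. p + c)"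
    using lborel_distr_plus[of c] unfolding add.commute[of _ c] by simp
  show "integrable lborel (\<lambda>p. G (p + c))"
    using assms by (subst (asm) *, subst (asm) integrable_distr_eq) auto
  show "(LINT p|lborel. G (p + c)) = (LINT p|lborel. G p)"
    by (subst (2) *, subst integral_distr) auto
qed

text \<open>The integral of \<open>H\<close> over the segment from \<open>p\<close> to \<open>p + u\<close> is \<open>G (p + u) - G p\<close>, and
integrating in \<open>p\<close> gives zero on one side and, by Fubini and translation invariance, the integral of \<open>H\<close>
on the other. Only the derivative along \<open>u\<close> enters, so the kernels, which are cut off by a
window in \<open>s\<close>, need be examined only in directions that leave the window fixed.\<close>

lemma integral_line_derivative_eq_0:
  fixes G H :: "'a::euclidean_space \<Rightarrow> real"
  assumes der: "\<And>p. ((\<lambda>h. G (p + h *\<^sub>R u)) has_real_derivative H p) (at 0)"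
    and G: "integrable lborel G" and H: "integrable lborel H"
  shows "(LINT p|lborel. H p) = 0"
proof -
  have [measurable]: "H \<in> borel_measurable borel" "G \<in> borel_measurable borel"
    using H G by auto
  define F :: "real \<times> 'a \<Rightarrow> real" where
    "F = (\<lambda>(h, p). indicator {0..1} h * H (p + h *\<^sub>R u))"
  have F_int: "integrable (lborel \<Otimes>\<^sub>M lborel) F"
  proof (rule lborel_pair.Fubini_integrable)
    have "F \<in> borel_measurable borel" unfolding F_def case_prod_unfold by measurable
    then show "F \<in> borel_measurable (lborel \<Otimes>\<^sub>M lborel)" by (simp add: lborel_prod)
    have "(LINT p|lborel. norm (F (h, p))) = indicator {0..1} h * (LINT p|lborel. \<bar>H p\<bar>)" for h
      using integral_translate[of "\<lambda>p. \<bar>H p\<bar>" "h *\<^sub>R u"] H by (simp add: F_def abs_mult)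
    then show "integrable lborel (\<lambda>h. LINT p|lborel. norm (F (h, p)))" by simp
    show "AE h in lborel. integrable lborel (\<lambda>p. F (h, p))"
      by (simp add: F_def integrable_translate[OF H])
  qed
  \<comment> \<open>\<open>H\<close> need not be continuous along the line, so the Henstock--Kurzweil form of the
    fundamental theorem is used. It agrees with the Lebesgue integral for almost every \<open>p\<close>.\<close>
  have slice: "(LINT h|lborel. F (h, p)) = G (p + u) - G p" if "integrable lborel (\<lambda>h. F (h, p))" for p
  proof -
    have "((\<lambda>h. H (p + h *\<^sub>R u)) has_integral G (p + 1 *\<^sub>R u) - G (p + 0 *\<^sub>R u)) {0..1}"
    proof (rule fundamental_theorem_of_calculus)
      fix x :: real
      have "((\<lambda>h. G (p + x *\<^sub>R u + (h - x) *\<^sub>R u)) has_real_derivative H (p + x *\<^sub>R u) * 1) (at x)"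
        by (rule DERIV_chain2[where f = "\<lambda>h. G (p + x *\<^sub>R u + h *\<^sub>R u)"])
          (auto intro!: der derivative_eq_intros)
      then show "((\<lambda>h. G (p + h *\<^sub>R u)) has_vector_derivative H (p + x *\<^sub>R u)) (at x within {0..1})"
        by (auto simp: algebra_simps has_real_derivative_iff_has_vector_derivative
            intro: has_vector_derivative_at_within)
    qed simp
    moreover have "set_integrable lborel {0..1} (\<lambda>h. H (p + h *\<^sub>R u))"
      using that by (simp add: set_integrable_def F_def)
    ultimately show ?thesis
      using set_borel_integral_eq_integral(2)[of "{0..1}" "\<lambda>h. H (p + h *\<^sub>R u)"]
      by (simp add: integral_unique set_lebesgue_integral_def F_def)
  qed
  have "(LINT p|lborel. LINT h|lborel. F (h, p)) = (LINT p|lborel. G (p + u) - G p)"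
    using lborel_pair.AE_integrable_snd[of "\<lambda>h p. F (h, p)"] F_int
    by (intro integral_cong_AE) (auto elim!: eventually_mono simp: slice)
  also have "\<dots> = 0"
    using integral_translate[OF G] integrable_translate[OF G] G by simp
  finally have "0 = (LINT p|lborel. LINT h|lborel. F (h, p))" ..
  also have "\<dots> = (LINT h|lborel. LINT p|lborel. F (h, p))"
    using lborel_pair.Fubini_integral[of "\<lambda>h p. F (h, p)"] F_int by simp
  also have "\<dots> = (LINT h|lborel. indicator {0..1::real} h * (LINT p|lborel. H p))"
    by (simp add: F_def integral_translate[OF H])
  also have "\<dots> = (LINT p|lborel. H p)" by (simp add: content_real)
  finally show ?thesis ..
qed

section \<open>Kernels as images of profiles\<close>

text \<open>The map \<open>kin_arg r\<close> with the inverse matrix written out. Unlike \<open>matrix_inv\<close>, which is a choice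
of an inverse, this formula is visibly Borel.\<close>

definition kin_inv :: "real \<Rightarrow> 'd::finite point \<Rightarrow> 'd point" where
  "kin_inv r p = (fst p / r\<^sup>2,
     (- 2 * h2 r / r ^ 4) *\<^sub>R fst (snd p) + (2 * (fst p / r\<^sup>2) * g2 r / r ^ 4) *\<^sub>R snd (snd p),
     (2 * h1 r / (fst p / r\<^sup>2 * r ^ 4)) *\<^sub>R fst (snd p) + (- 2 * g1 r / r ^ 4) *\<^sub>R snd (snd p))"

lemma kin_arg_eq:
  "kin_arg r p = (fst p / r\<^sup>2, block_act (matrix_inv (\<A> (fst p / r\<^sup>2) r)) (snd p))"
  by (cases p) simp

lemma kin_arg_eq_kin_inv:
  assumes "r > 0" "fst p \<noteq> 0"
  shows "kin_arg r p = kin_inv r p"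
proof -
  have "fst p / r\<^sup>2 \<noteq> 0" using assms by simp
  from matrix_inv_\<A>[OF this assms(1)] show ?thesis
    unfolding kin_arg_eq kin_inv_def block_act_def by simp
qed

lemma snd_traj:
  assumes "r > 0"
  shows "snd (traj r m) = block_act (\<A> (fst m) r) (snd m)"
  by (simp add: traj_def block_act_def \<A>_eq[OF assms])

lemma kin_inv_traj:
  assumes "r > 0" "fst m \<noteq> 0"
  shows "kin_inv r (traj r m) = m"
proof -
  have "kin_inv r (traj r m) = kin_arg r (traj r m)"
    using assms by (intro kin_arg_eq_kin_inv[symmetric]) (auto simp: traj_def)
  also have "\<dots> = (fst m, block_act (matrix_inv (\<A> (fst m) r)) (snd (traj r m)))"
    using assms by (simp add: kin_arg_eq traj_def)
  also have "\<dots> = m"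
    using assms by (simp add: snd_traj block_act_mult matrix_inv_\<A>_left block_act_one)
  finally show ?thesis .
qed

lemma kin_inv_measurable [measurable]: "kin_inv r \<in> borel_measurable borel"
  unfolding kin_inv_def [abs_def] by (intro borel_measurable_Pair) measurable

lemma kin_mult_eq: "kin_mult z p = (fst z + fst p,
    fst (snd z) + fst (snd p) + fst p *\<^sub>R snd (snd z), snd (snd z) + snd (snd p))"
  by (cases z; cases p) auto

lemma continuous_on_kin_mult [continuous_intros]:
  "continuous_on S p \<Longrightarrow> continuous_on S (\<lambda>x. kin_mult z (p x))"
  unfolding kin_mult_eq by (intro continuous_intros)

lemma kin_mult_measurable [measurable]: "kin_mult z \<in> borel_measurable borel"
  by (intro borel_measurable_continuous_onI continuous_intros)

text \<open>The density of the image under \<open>traj r\<close> of the (vector) measure with density \<open>j\<close>, for \<open>j\<close>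
vanishing outside the time window. All four kernels have this form.\<close>

definition pushed :: "real \<Rightarrow> ('d::finite point \<Rightarrow> 'b::real_vector) \<Rightarrow> 'd point \<Rightarrow> 'b" where
  "pushed r j p = (if kin_window r p
     then (2 ^ CARD('d) / r ^ hom_dim TYPE('d)) *\<^sub>R j (kin_inv r p) else 0)"

lemma kin_window_measurable [measurable]: "Measurable.pred borel (kin_window r)"
  unfolding kin_window_def [abs_def] by measurable

lemma
  fixes j G :: "'d::finite point \<Rightarrow> 'b::euclidean_space"
  assumes r: "r > 0" and [measurable]: "j \<in> borel_measurable borel" "G \<in> borel_measurable borel"
    and off: "\<And>m. fst m \<notin> {-2<..<-1} \<Longrightarrow> j m = 0"
  shows integrable_pushed:
      "integrable lborel (\<lambda>p. pushed r j p \<bullet> G p) \<longleftrightarrow> integrable lborel (\<lambda>m. j m \<bullet> G (traj r m))"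
    and integral_pushed:
      "(LINT p|lborel. pushed r j p \<bullet> G p) = (LINT m|lborel. j m \<bullet> G (traj r m))"
proof -
  define H where "H p = (if kin_window r p then j (kin_inv r p) \<bullet> G p else 0)" for p
  have [measurable]: "H \<in> borel_measurable borel" unfolding H_def [abs_def] by measurable
  have 1: "pushed r j p \<bullet> G p = (2 ^ CARD('d) / r ^ hom_dim TYPE('d)) *\<^sub>R H p" for p
    by (simp add: pushed_def H_def)
  have 2: "H (traj r m) = j m \<bullet> G (traj r m)" for m
  proof -
    have "kin_window r (traj r m) \<longleftrightarrow> fst m \<in> {-2<..<-1}"
      using r by (simp add: kin_window_def traj_def)
    then show ?thesis
      using off[of m] kin_inv_traj[OF r, of m] by (auto simp: H_def)
  qed
  show "integrable lborel (\<lambda>p. pushed r j p \<bullet> G p) \<longleftrightarrow> integrable lborel (\<lambda>m. j m \<bullet> G (traj r m))"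
    unfolding 1 by (subst integrable_traj[OF _ r]) (simp_all add: 2)
  show "(LINT p|lborel. pushed r j p \<bullet> G p) = (LINT m|lborel. j m \<bullet> G (traj r m))"
    unfolding 1 by (subst integral_traj[OF _ r]) (simp_all add: 2)
qed

text \<open>The set that contains the support of \<open>\<psi>\<close>. In it \<open>a\<close> is bounded and
bounded away from zero.\<close>

definition cyl :: "'d::finite point set" where
  "cyl = {-2<..<-1} \<times> ball 0 1 \<times> ball 0 1"

lemma cyl_measurable [measurable]: "cyl \<in> sets borel"
  unfolding cyl_def by (intro borel_open open_Times) auto

lemma emeasure_cyl: "emeasure lborel (cyl :: 'd::finite point set) < top"
  unfolding cyl_def infinity_ennreal_def[symmetric]
  by (intro emeasure_bounded_finite bounded_Times) auto

lemma cyl_fst: "m \<in> cyl \<Longrightarrow> \<bar>fst m\<bar> \<le> 2"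
  by (auto simp: cyl_def)

lemma kin_conv_exists_pushed_iff:
  fixes j g :: "'d::finite point \<Rightarrow> 'b::euclidean_space"
  assumes r: "r > 0" and [measurable]: "j \<in> borel_measurable borel" "g \<in> borel_measurable borel"
    and off: "\<And>m. m \<notin> cyl \<Longrightarrow> j m = 0"
  shows "kin_conv_exists (pushed r j) g z
    \<longleftrightarrow> integrable lborel (\<lambda>m. j m \<bullet> g (kin_mult z (traj r m)))"
proof -
  have "fst m \<notin> {-2<..<-1} \<Longrightarrow> j m = 0" for m
    by (rule off) (auto simp: cyl_def)
  then show ?thesis
    unfolding kin_conv_exists_def by (subst integrable_pushed[OF r]) auto
qed

lemma kin_conv_exists_pushed:
  fixes j g :: "'d::finite point \<Rightarrow> 'b::euclidean_space"
  assumes r: "r > 0" and [measurable]: "j \<in> borel_measurable borel" "g \<in> borel_measurable borel"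
    and off: "\<And>m. m \<notin> cyl \<Longrightarrow> j m = 0"
    and j: "\<And>m. m \<in> cyl \<Longrightarrow> norm (j m) \<le> B" and g: "\<And>p. norm (g p) \<le> C"
  shows "kin_conv_exists (pushed r j) g z"
proof -
  have "integrable lborel (\<lambda>m. j m \<bullet> g (kin_mult z (traj r m)))"
  proof (rule integrableI_bounded_set[where A = cyl and B = "B * C"])
    have "norm (j m \<bullet> g (kin_mult z (traj r m))) \<le> B * C" if "m \<in> cyl" for m
    proof -
      have "norm (j m \<bullet> g (kin_mult z (traj r m))) \<le> norm (j m) * norm (g (kin_mult z (traj r m)))"
        by (simp add: Cauchy_Schwarz_ineq2)
      also have "\<dots> \<le> B * C"
        by (intro mult_mono j g that norm_ge_zero order_trans[OF norm_ge_zero j[OF that]])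
      finally show ?thesis .
    qed
    then show "AE m in lborel. m \<in> cyl \<longrightarrow> norm (j m \<bullet> g (kin_mult z (traj r m))) \<le> B * C"
      by simp
  qed (simp_all add: emeasure_cyl off)
  then show ?thesis
    by (subst kin_conv_exists_pushed_iff[OF r]) (auto simp: off)
qed

lemma kin_conv_pushed:
  fixes j g :: "'d::finite point \<Rightarrow> 'b::euclidean_space"
  assumes r: "r > 0" and [measurable]: "j \<in> borel_measurable borel" "g \<in> borel_measurable borel"
    and off: "\<And>m. m \<notin> cyl \<Longrightarrow> j m = 0"
  shows "kin_conv (pushed r j) g z = (LINT m|lborel. j m \<bullet> g (kin_mult z (traj r m)))"
proof -
  have "fst m \<notin> {-2<..<-1} \<Longrightarrow> j m = 0" for m
    by (rule off) (auto simp: cyl_def)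
  then show ?thesis
    unfolding kin_conv_def by (subst integral_pushed[OF r]) auto
qed

lemma kin_window_fst: "r > 0 \<Longrightarrow> kin_window r p \<Longrightarrow> fst p \<noteq> 0"
  by (auto simp: kin_window_def)

lemma fst_kin_inv: "fst (kin_inv r p) = fst p / r\<^sup>2"
  by (simp add: kin_inv_def)

lemma K_eq_pushed: "r > 0 \<Longrightarrow> K \<psi> r = pushed r \<psi>"
  by (rule ext) (simp add: K_def pushed_def kin_arg_eq_kin_inv kin_window_fst)

text \<open>In terms of \<open>m = (a, b)\<close> the factor \<open>s / r\<close> in two of the kernels is \<open>r a\<close>, because \<open>s = r\<^sup>2 a\<close>.
This is half the time derivative \<open>2 r a\<close> of the trajectories.\<close>

lemma K_tilde_eq_pushed: "r > 0 \<Longrightarrow> K_tilde \<psi> r = pushed r (\<lambda>m. - (2 * r * fst m) * \<psi> m)"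
  by (rule ext) (simp add: K_tilde_def pushed_def kin_arg_eq_kin_inv kin_window_fst
      fst_kin_inv field_simps power2_eq_square)

lemma K_vec_eq_pushed:
  "r > 0 \<Longrightarrow> K_vec \<psi> r = pushed r (\<lambda>m. - \<psi> m *\<^sub>R \<F> (fst m) r (snd m))"
  by (rule ext) (simp add: K_vec_def pushed_def kin_arg_eq_kin_inv kin_window_fst)

lemma K_pi_eq_pushed:
  assumes "r > 0"
  shows "K_pi \<psi> r = pushed r (\<lambda>m. (2 * r * fst m) *\<^sub>R
    ((2 * fst m * g2 r / r ^ 4) *\<^sub>R grad_x \<psi> m + (- 2 * g1 r / r ^ 4) *\<^sub>R grad_v \<psi> m))"
proof
  fix p
  show "K_pi \<psi> r p = pushed r (\<lambda>m. (2 * r * fst m) *\<^sub>R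
    ((2 * fst m * g2 r / r ^ 4) *\<^sub>R grad_x \<psi> m + (- 2 * g1 r / r ^ 4) *\<^sub>R grad_v \<psi> m)) p"
  proof (cases "kin_window r p")
    case True
    then have nz: "fst p \<noteq> 0" by (rule kin_window_fst[OF assms])
    have a: "fst (kin_inv r p) \<noteq> 0" using nz assms by (simp add: fst_kin_inv)
    have c: "2 ^ (CARD('a) + 1) * fst p / r ^ (hom_dim TYPE('a) + 1)
        = 2 ^ CARD('a) / r ^ hom_dim TYPE('a) * (2 * r * fst (kin_inv r p))"
      using assms by (simp add: fst_kin_inv field_simps power2_eq_square)
    show ?thesis
      unfolding K_pi_def pushed_def kin_arg_eq_kin_inv[OF assms nz] matrix_inv_\<A>[OF a assms] c
      by (simp add: True)
  qed (simp add: K_pi_def pushed_def)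
qed

section \<open>Directional derivatives on phase space\<close>

lemma axis_x_Basis: "(0, axis i 1, 0) \<in> (Basis :: 'd::finite point set)"
  by (auto simp: Basis_prod_def Basis_vec_def zero_prod_def)

lemma axis_v_Basis: "(0, 0, axis i 1) \<in> (Basis :: 'd::finite point set)"
  unfolding Basis_prod_def by (intro UnI2 imageI) (auto simp: Basis_vec_def)

lemma borel_measurable_vec_nth [measurable (raw)]:
  fixes f :: "'a \<Rightarrow> real ^ 'n"
  assumes "f \<in> borel_measurable M"
  shows "(\<lambda>x. f x $ i) \<in> borel_measurable M"
  by (rule measurable_compose[OF assms borel_measurable_continuous_onI]) (intro continuous_intros)

lemma linear_dir_deriv:
  assumes "g differentiable (at z)"
  shows "linear (\<lambda>u. dir_deriv u g z)"
  unfolding dir_deriv_def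
  using assms frechet_derivative_works has_derivative_linear by blast

lemma dir_deriv_point:
  fixes g :: "'d::finite point \<Rightarrow> real"
  assumes "g differentiable (at z)"
  shows "dir_deriv (a, x, v) g z = a * partial_t g z + x \<bullet> grad_x g z + v \<bullet> grad_v g z"
proof -
  interpret L: linear "\<lambda>u. dir_deriv u g z" by (rule linear_dir_deriv[OF assms])
  have "dir_deriv (a, 0, 0) g z = a * partial_t g z"
    using L.scale[of a "(1, 0, 0)"] by (simp add: partial_t_def)
  moreover have "dir_deriv (0, x, 0) g z = x \<bullet> grad_x g z"
  proof -
    have "(0::real, x, 0::real ^ 'd) = (\<Sum>i\<in>UNIV. x $ i *\<^sub>R (0, axis i 1, 0))"
      by (intro prod_eqI)
        (use basis_expansion[of x] in \<open>simp_all add: fst_sum snd_sum scalar_mult_eq_scaleR\<close>)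
    then show ?thesis by (simp add: L.sum L.scale grad_x_def inner_vec_def del: scaleR_Pair)
  qed
  moreover have "dir_deriv (0, 0, v) g z = v \<bullet> grad_v g z"
  proof -
    have "(0::real, 0::real ^ 'd, v) = (\<Sum>i\<in>UNIV. v $ i *\<^sub>R (0, 0, axis i 1))"
      by (intro prod_eqI)
        (use basis_expansion[of v] in \<open>simp_all add: fst_sum snd_sum scalar_mult_eq_scaleR\<close>)
    then show ?thesis by (simp add: L.sum L.scale grad_v_def inner_vec_def del: scaleR_Pair)
  qed
  moreover have "dir_deriv (a, x, v) g z
      = dir_deriv (a, 0, 0) g z + dir_deriv (0, x, 0) g z + dir_deriv (0, 0, v) g z"
    by (simp flip: L.add)
  ultimately show ?thesis by simp
qed

lemma has_vector_derivative_along: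
  assumes g: "g differentiable (at (\<gamma> t))" and \<gamma>: "(\<gamma> has_vector_derivative u) (at t)"
  shows "((\<lambda>t. g (\<gamma> t)) has_vector_derivative dir_deriv u g (\<gamma> t)) (at t)"
proof -
  have "(g has_derivative frechet_derivative g (at (\<gamma> t))) (at (\<gamma> t))"
    using g frechet_derivative_works by blast
  from vector_derivative_diff_chain_within[OF \<gamma> has_derivative_at_withinI[OF this]]
  show ?thesis by (simp add: dir_deriv_def comp_def)
qed

lemma
  fixes g :: "'a::real_normed_vector \<Rightarrow> real ^ 'n"
  assumes "g differentiable (at z)"
  shows differentiable_component: "(\<lambda>z. g z $ i) differentiable (at z)"
    and dir_deriv_component: "dir_deriv u (\<lambda>z. g z $ i) z = dir_deriv u g z $ i"
proof -
  have *: "((\<lambda>z. g z $ i) has_derivative (\<lambda>u. frechet_derivative g (at z) u $ i)) (at z)"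
    using assms frechet_derivative_works
      bounded_linear.has_derivative[OF bounded_linear_vec_nth[of i]] by blast
  then show "(\<lambda>z. g z $ i) differentiable (at z)" by (rule differentiableI)
  show "dir_deriv u (\<lambda>z. g z $ i) z = dir_deriv u g z $ i"
    using frechet_derivative_at[OF *] by (simp add: dir_deriv_def fun_eq_iff)
qed

lemma
  fixes g :: "'d::finite point \<Rightarrow> real"
  assumes "smooth g"
  shows continuous_on_grad_x: "continuous_on UNIV (grad_x g)"
    and continuous_on_grad_v: "continuous_on UNIV (grad_v g)"
  unfolding grad_x_def grad_v_def
  by (intro continuous_on_vec_lambda differentiable_borel(1)
      smooth_dir_deriv_differentiable[OF assms] axis_x_Basis axis_v_Basis)+

lemma
  fixes S :: "'d::finite point \<Rightarrow> real ^ 'd"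
  assumes S: "schwartz S"
  shows div_v_measurable: "div_v S \<in> borel_measurable borel"
    and div_v_bounded: "\<exists>C. \<forall>z. norm (div_v S z) \<le> C"
proof -
  have smooth: "smooth S" using S by (simp add: schwartz_def)
  have div: "div_v S = (\<lambda>z. \<Sum>i\<in>UNIV. dir_deriv (0, 0, axis i 1) S z $ i)"
    by (simp add: fun_eq_iff div_v_def dir_deriv_component[OF smooth_differentiable[OF smooth]])
  have "continuous_on UNIV (div_v S)"
    unfolding div by (intro continuous_intros differentiable_borel(1)
      smooth_dir_deriv_differentiable[OF smooth] axis_v_Basis)
  then show "div_v S \<in> borel_measurable borel" by (rule borel_measurable_continuous_onI)
  have "\<forall>i. \<exists>C. \<forall>z. norm (dir_deriv (0, 0, axis i 1) S z) \<le> C"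
    using schwartz_dir_deriv_bounded[OF S axis_v_Basis] by meson
  then obtain C where C: "\<And>i z. norm (dir_deriv (0, 0, axis i 1) S z) \<le> C i" by metis
  have "norm (div_v S z) \<le> (\<Sum>i\<in>UNIV. C i)" for z
    unfolding div by (rule sum_norm_le) (rule order_trans[OF Finite_Cartesian_Product.norm_nth_le C])
  then show "\<exists>C. \<forall>z. norm (div_v S z) \<le> C" by blast
qed

lemma schwartz_grad_v_bounded:
  fixes f :: "'d::finite point \<Rightarrow> real"
  assumes f: "schwartz f"
  shows "\<exists>C. \<forall>z. norm (grad_v f z) \<le> C"
proof -
  have "\<forall>i. \<exists>C. \<forall>z. norm (dir_deriv (0, 0, axis i 1) f z) \<le> C"
    using schwartz_dir_deriv_bounded[OF f axis_v_Basis] by meson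
  then obtain C where C: "\<And>i z. norm (dir_deriv (0, 0, axis i 1) f z) \<le> C i" by metis
  have "norm (grad_v f z) \<le> (\<Sum>i\<in>UNIV. C i)" for z
    by (rule order_trans[OF norm_le_l1_cart sum_mono]) (use C in \<open>simp add: grad_v_def\<close>)
  then show ?thesis by blast
qed

section \<open>The divergence term\<close>

locale profile =
  fixes \<psi> :: "'d::finite point \<Rightarrow> real"
  assumes test: "test_function \<psi>" and supp: "support \<psi> \<subseteq> cyl"
begin

lemma smooth_psi: "smooth \<psi>" and compact_support: "compact (support \<psi>)"
  using test by (auto simp: test_function_def)

lemma psi_measurable [measurable]: "\<psi> \<in> borel_measurable borel"
  by (intro differentiable_borel(2) smooth_differentiable smooth_psi)

lemma grad_psi_measurable [measurable]:
  "grad_x \<psi> \<in> borel_measurable borel" "grad_v \<psi> \<in> borel_measurable borel"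
  by (intro borel_measurable_continuous_onI continuous_on_grad_x continuous_on_grad_v smooth_psi)+

lemma psi_outside: "m \<notin> cyl \<Longrightarrow> \<psi> m = 0"
  using supp not_in_support by blast

lemma grad_psi_outside_support:
  "m \<notin> support \<psi> \<Longrightarrow> grad_x \<psi> m = 0" "m \<notin> support \<psi> \<Longrightarrow> grad_v \<psi> m = 0"
  by (simp_all add: vec_eq_iff grad_x_def grad_v_def dir_deriv_outside_support)

lemma grad_psi_outside: "m \<notin> cyl \<Longrightarrow> grad_x \<psi> m = 0" "m \<notin> cyl \<Longrightarrow> grad_v \<psi> m = 0"
  using supp grad_psi_outside_support by blast+

lemma psi_bounded: "\<exists>C. \<forall>m. norm (\<psi> m) \<le> C"
  by (rule bounded_of_compact_support[OF _ compact_support, of \<psi>])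
    (auto intro: differentiable_borel(1) smooth_differentiable smooth_psi simp: not_in_support)

lemma grad_psi_bounded:
  "\<exists>C. \<forall>m. norm (grad_x \<psi> m) \<le> C" "\<exists>C. \<forall>m. norm (grad_v \<psi> m) \<le> C"
  by (rule bounded_of_compact_support[OF continuous_on_grad_x[OF smooth_psi] compact_support],
      auto simp: grad_psi_outside_support)
    (rule bounded_of_compact_support[OF continuous_on_grad_v[OF smooth_psi] compact_support],
      auto simp: grad_psi_outside_support)

definition pi_profile :: "real \<Rightarrow> 'd point \<Rightarrow> real ^ 'd" where
  "pi_profile r m = (2 * r * fst m) *\<^sub>R
    ((2 * fst m * g2 r / r ^ 4) *\<^sub>R grad_x \<psi> m + (- 2 * g1 r / r ^ 4) *\<^sub>R grad_v \<psi> m)"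

lemma K_pi_eq: "r > 0 \<Longrightarrow> K_pi \<psi> r = pushed r (pi_profile r)"
  unfolding pi_profile_def [abs_def] by (rule K_pi_eq_pushed)

lemma pi_profile_measurable [measurable]: "pi_profile r \<in> borel_measurable borel"
  unfolding pi_profile_def [abs_def] by measurable

lemma pi_profile_outside: "m \<notin> cyl \<Longrightarrow> pi_profile r m = 0"
  by (simp add: pi_profile_def grad_psi_outside)

lemma pi_profile_bounded: "\<exists>C. \<forall>m\<in>cyl. norm (pi_profile r m) \<le> C"
proof -
  obtain C1 C2 where C: "\<And>m. norm (grad_x \<psi> m) \<le> C1" "\<And>m. norm (grad_v \<psi> m) \<le> C2"
    using grad_psi_bounded by blast
  have "norm (pi_profile r m) \<le> \<bar>2 * r\<bar> * 2 *
      (2 * \<bar>2 * g2 r / r ^ 4\<bar> * C1 + \<bar>2 * g1 r / r ^ 4\<bar> * C2)" if "m \<in> cyl" for m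
  proof -
    define \<alpha> \<beta> where "\<alpha> = \<bar>2 * g2 r / r ^ 4\<bar>" and "\<beta> = \<bar>2 * g1 r / r ^ 4\<bar>"
    have \<alpha>\<beta>: "0 \<le> \<alpha>" "0 \<le> \<beta>" by (simp_all add: \<alpha>_def \<beta>_def)
    have "norm (pi_profile r m) = \<bar>2 * r\<bar> * \<bar>fst m\<bar> *
        norm ((2 * fst m * g2 r / r ^ 4) *\<^sub>R grad_x \<psi> m + (- 2 * g1 r / r ^ 4) *\<^sub>R grad_v \<psi> m)"
      unfolding pi_profile_def norm_scaleR abs_mult ..
    also have "\<dots> \<le> \<bar>2 * r\<bar> * \<bar>fst m\<bar> * (\<bar>fst m\<bar> * \<alpha> * norm (grad_x \<psi> m) + \<beta> * norm (grad_v \<psi> m))"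
      by (intro mult_left_mono order_trans[OF norm_triangle_ineq])
        (simp_all add: \<alpha>_def \<beta>_def abs_mult mult_ac)
    also have "\<dots> \<le> \<bar>2 * r\<bar> * 2 * (2 * \<alpha> * C1 + \<beta> * C2)"
      using \<alpha>\<beta> cyl_fst[OF that] by (intro mult_mono add_mono C) auto
    finally show ?thesis unfolding \<alpha>_def \<beta>_def .
  qed
  then show ?thesis by blast
qed

text \<open>Moving \<open>w\<close> keeps \<open>s\<close> and hence \<open>a\<close> and the window fixed, and moves the argument of \<open>\<psi>\<close>
linearly, along the second column of the inverse matrix. This produces exactly the combination of
\<open>grad_x \<psi>\<close> and \<open>grad_v \<psi>\<close> in \<open>K_pi\<close>.\<close>

lemma K_tilde_line_derivative:
  assumes r: "r > 0"
  shows "((\<lambda>h. K_tilde \<psi> r (p + h *\<^sub>R (0, 0, axis i 1))) has_real_derivative - K_pi \<psi> r p $ i) (at 0)"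
proof (cases "kin_window r p")
  case False
  then have "\<not> kin_window r (p + h *\<^sub>R (0, 0, axis i 1))" for h by (simp add: kin_window_def)
  then show ?thesis using False by (simp add: K_tilde_def K_pi_def)
next
  case True
  define q where "q = kin_inv r p"
  define a where "a = fst q"
  define c where "c = 2 ^ CARD('d) / r ^ hom_dim TYPE('d)"
  define u :: "'d point" where
    "u = (0, (2 * a * g2 r / r ^ 4) *\<^sub>R axis i 1, (- 2 * g1 r / r ^ 4) *\<^sub>R axis i 1)"
  have win: "kin_window r (p + h *\<^sub>R (0, 0, axis i 1))" for h
    using True by (simp add: kin_window_def)
  have inv: "kin_inv r (p + h *\<^sub>R (0, 0, axis i 1)) = q + h *\<^sub>R u" for h
    by (simp add: kin_inv_def q_def u_def a_def scaleR_add_right mult_ac)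
  have eq: "K_tilde \<psi> r (p + h *\<^sub>R (0, 0, axis i 1)) = - (c * (2 * r * a)) * \<psi> (q + h *\<^sub>R u)" for h
    unfolding K_tilde_eq_pushed[OF r] pushed_def inv
    by (simp add: win c_def a_def del: scaleR_Pair) (simp add: u_def)
  have dif: "\<psi> differentiable (at q)" by (intro smooth_differentiable smooth_psi)
  have "((\<lambda>h. \<psi> (q + h *\<^sub>R u)) has_vector_derivative dir_deriv u \<psi> (q + 0 *\<^sub>R u)) (at 0)"
    by (rule has_vector_derivative_along) (auto intro!: derivative_eq_intros simp: dif)
  then have "((\<lambda>h. \<psi> (q + h *\<^sub>R u)) has_real_derivative dir_deriv u \<psi> q) (at 0)"
    by (simp add: has_real_derivative_iff_has_vector_derivative)
  then have "((\<lambda>h. - (c * (2 * r * a)) * \<psi> (q + h *\<^sub>R u)) has_real_derivative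
      - (c * (2 * r * a)) * dir_deriv u \<psi> q) (at 0)" by (rule DERIV_cmult)
  moreover have "dir_deriv u \<psi> q = (2 * a * g2 r / r ^ 4) * grad_x \<psi> q $ i + (- 2 * g1 r / r ^ 4) * grad_v \<psi> q $ i"
    unfolding u_def dir_deriv_point[OF dif] by (simp add: inner_axis inner_commute)
  then have "- (c * (2 * r * a)) * dir_deriv u \<psi> q = - K_pi \<psi> r p $ i"
    unfolding K_pi_eq[OF r] pushed_def
    by (simp add: True c_def pi_profile_def q_def[symmetric] a_def)
  ultimately show ?thesis unfolding eq by simp
qed

lemma kin_conv_exists_K:
  assumes r: "r > 0" and [measurable]: "g \<in> borel_measurable borel" and g: "\<And>p. norm (g p) \<le> C"
  shows "kin_conv_exists (K \<psi> r) g z"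
proof -
  obtain B where "\<And>m. norm (\<psi> m) \<le> B" using psi_bounded by blast
  then show ?thesis
    unfolding K_eq_pushed[OF r]
    by (intro kin_conv_exists_pushed[where B = B and C = C] r g) (auto simp: psi_outside)
qed

lemma kin_conv_exists_K_tilde:
  assumes r: "r > 0" and [measurable]: "g \<in> borel_measurable borel" and g: "\<And>p. norm (g p) \<le> C"
  shows "kin_conv_exists (K_tilde \<psi> r) g z"
proof -
  obtain B where B: "\<And>m. norm (\<psi> m) \<le> B" using psi_bounded by blast
  have "norm (- (2 * r * fst m) * \<psi> m) \<le> 2 * r * 2 * B" if "m \<in> cyl" for m
  proof -
    have "norm (- (2 * r * fst m) * \<psi> m) = 2 * r * \<bar>fst m\<bar> * norm (\<psi> m)"
      using r by (simp add: abs_mult)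
    also have "\<dots> \<le> 2 * r * 2 * B"
      using r cyl_fst[OF that] by (intro mult_mono B) auto
    finally show ?thesis .
  qed
  then show ?thesis
    unfolding K_tilde_eq_pushed[OF r]
    by (intro kin_conv_exists_pushed[where B = "2 * r * 2 * B" and C = C] r g) (auto simp: psi_outside)
qed

lemma kin_conv_exists_K_pi:
  assumes r: "r > 0" and [measurable]: "g \<in> borel_measurable borel" and g: "\<And>p. norm (g p) \<le> C"
  shows "kin_conv_exists (K_pi \<psi> r) g z"
proof -
  obtain B where "\<And>m. m \<in> cyl \<Longrightarrow> norm (pi_profile r m) \<le> B" using pi_profile_bounded by blast
  then show ?thesis
    unfolding K_pi_eq[OF r]
    by (intro kin_conv_exists_pushed[where B = B and C = C] r g) (auto simp: pi_profile_outside)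
qed

lemma integrable_K_pi_component:
  assumes r: "r > 0" and [measurable]: "g \<in> borel_measurable borel" and g: "\<And>p. norm (g p) \<le> C"
  shows "integrable lborel (\<lambda>p. K_pi \<psi> r p $ i * g (kin_mult z p))"
proof -
  obtain B where B: "\<And>m. m \<in> cyl \<Longrightarrow> norm (pi_profile r m) \<le> B" using pi_profile_bounded by blast
  have "kin_conv_exists (pushed r (\<lambda>m. pi_profile r m $ i)) g z"
    by (intro kin_conv_exists_pushed[where B = B and C = C] r g order_trans[OF Finite_Cartesian_Product.norm_nth_le B])
      (auto simp: pi_profile_outside)
  moreover have "pushed r (\<lambda>m. pi_profile r m $ i) p = K_pi \<psi> r p $ i" for p
    by (simp add: K_pi_eq[OF r] pushed_def)
  ultimately show ?thesis by (simp add: kin_conv_exists_def)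
qed

text \<open>Both \<open>K_tilde\<close> and \<open>S \<circ> kin_mult z\<close> are differentiated along the same constant direction,
because \<open>kin_mult z\<close> acts on \<open>w\<close> as a translation. The integral of the derivative of the product vanishes.\<close>

lemma kin_conv_K_pi:
  assumes r: "r > 0" and S: "schwartz S"
  shows "kin_conv (K_pi \<psi> r) S z = kin_conv (K_tilde \<psi> r) (div_v S) z"
proof -
  define e :: "'d \<Rightarrow> 'd point" where "e i = (0, 0, axis i 1)" for i
  have e: "e i \<in> Basis" for i by (simp add: e_def axis_v_Basis)
  have smooth: "smooth S" using S by (simp add: schwartz_def)
  note dif = smooth_differentiable[OF smooth] smooth_dir_deriv_differentiable[OF smooth e]
  obtain C where C: "\<And>z. norm (S z) \<le> C" using schwartz_bounded[OF S] by blast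
  have S_comp: "(\<lambda>z. S z $ i) \<in> borel_measurable borel" for i
    by (intro differentiable_borel(2) differentiable_component dif)
  have DS_comp: "(\<lambda>z. dir_deriv (e i) S z $ i) \<in> borel_measurable borel" for i
    by (intro differentiable_borel(2) differentiable_component dif)
  have int1: "integrable lborel (\<lambda>p. K_tilde \<psi> r p * S (kin_mult z p) $ i)" for i
    using kin_conv_exists_K_tilde[OF r S_comp[of i] order_trans[OF Finite_Cartesian_Product.norm_nth_le C]]
    by (simp add: kin_conv_exists_def)
  have int2: "integrable lborel (\<lambda>p. K_tilde \<psi> r p * dir_deriv (e i) S (kin_mult z p) $ i)" for i
  proof -
    obtain D where D: "\<And>z. norm (dir_deriv (e i) S z) \<le> D"
      using schwartz_dir_deriv_bounded[OF S e[of i]] by blast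
    show ?thesis
      using kin_conv_exists_K_tilde[OF r DS_comp[of i] order_trans[OF Finite_Cartesian_Product.norm_nth_le D]]
      by (simp add: kin_conv_exists_def)
  qed
  have int3: "integrable lborel (\<lambda>p. K_pi \<psi> r p $ i * S (kin_mult z p) $ i)" for i
    by (rule integrable_K_pi_component[OF r S_comp order_trans[OF Finite_Cartesian_Product.norm_nth_le C]])
  have parts: "(LINT p|lborel. K_pi \<psi> r p $ i * S (kin_mult z p) $ i)
      = (LINT p|lborel. K_tilde \<psi> r p * dir_deriv (e i) S (kin_mult z p) $ i)" for i
  proof -
    have "(LINT p|lborel. - K_pi \<psi> r p $ i * S (kin_mult z p) $ i
        + K_tilde \<psi> r p * dir_deriv (e i) S (kin_mult z p) $ i) = 0"
    proof (rule integral_line_derivative_eq_0[where G = "\<lambda>p. K_tilde \<psi> r p * S (kin_mult z p) $ i" and u = "e i"])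
      fix p
      have shift: "kin_mult z (p + h *\<^sub>R e i) = kin_mult z p + h *\<^sub>R e i" for h
        by (simp add: kin_mult_eq e_def algebra_simps)
      have "((\<lambda>h. S (kin_mult z p + h *\<^sub>R e i) $ i) has_vector_derivative
          dir_deriv (e i) (\<lambda>z. S z $ i) (kin_mult z p + 0 *\<^sub>R e i)) (at 0)"
        by (rule has_vector_derivative_along[of "\<lambda>z. S z $ i"])
          (auto intro!: derivative_eq_intros differentiable_component dif)
      then have "((\<lambda>h. S (kin_mult z (p + h *\<^sub>R e i)) $ i) has_real_derivative
          dir_deriv (e i) S (kin_mult z p) $ i) (at 0)"
        by (simp add: has_real_derivative_iff_has_vector_derivative dir_deriv_component[OF dif(1)] shift)
      from DERIV_mult[OF K_tilde_line_derivative[OF r, of p i, folded e_def] this]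
      show "((\<lambda>h. K_tilde \<psi> r (p + h *\<^sub>R e i) * S (kin_mult z (p + h *\<^sub>R e i)) $ i) has_real_derivative
          - K_pi \<psi> r p $ i * S (kin_mult z p) $ i
          + K_tilde \<psi> r p * dir_deriv (e i) S (kin_mult z p) $ i) (at 0)"
        by (simp add: mult.commute add.commute)
    qed (use int1 int2 int3 in auto)
    then show ?thesis using int2[of i] int3[of i] by (simp add: Bochner_Integration.integral_add)
  qed
  have "kin_conv (K_pi \<psi> r) S z = (LINT p|lborel. (\<Sum>i\<in>UNIV. K_pi \<psi> r p $ i * S (kin_mult z p) $ i))"
    by (simp add: kin_conv_def inner_vec_def)
  also have "\<dots> = (\<Sum>i\<in>UNIV. LINT p|lborel. K_tilde \<psi> r p * dir_deriv (e i) S (kin_mult z p) $ i)"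
    by (simp add: Bochner_Integration.integral_sum int3 parts)
  also have "\<dots> = (LINT p|lborel. (\<Sum>i\<in>UNIV. K_tilde \<psi> r p * dir_deriv (e i) S (kin_mult z p) $ i))"
    by (simp add: Bochner_Integration.integral_sum int2)
  also have "\<dots> = kin_conv (K_tilde \<psi> r) (div_v S) z"
    by (simp add: kin_conv_def div_v_def dir_deriv_component[OF dif(1)] e_def sum_distrib_left)
  finally show ?thesis .
qed

end

section \<open>The solution along trajectories\<close>

lemma isCont_0_dominated:
  fixes g :: "real \<Rightarrow> real"
  assumes "g 0 = 0" "\<And>r. \<bar>g r\<bar> \<le> C * \<bar>r\<bar> ^ n" "n > 0"
  shows "isCont g 0"
proof -
  have "((\<lambda>r. C * \<bar>r\<bar> ^ n) \<longlongrightarrow> C * \<bar>0\<bar> ^ n) (at (0::real))" by (intro tendsto_intros)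
  then have "((\<lambda>r. C * \<bar>r\<bar> ^ n) \<longlongrightarrow> 0) (at (0::real))" using \<open>n > 0\<close> by (simp add: zero_power)
  then have "(g \<longlongrightarrow> 0) (at 0)" by (rule Lim_null_comparison[rotated]) (simp add: assms(2))
  then show ?thesis by (simp add: isCont_def assms(1))
qed

lemma abs_cos_sin_combination:
  fixes \<alpha> \<beta> r :: real
  shows "\<bar>\<alpha> * sin r + \<beta> * cos r\<bar> \<le> \<bar>\<alpha>\<bar> + \<bar>\<beta>\<bar>"
proof -
  have "\<bar>\<alpha> * sin r + \<beta> * cos r\<bar> \<le> \<bar>\<alpha>\<bar> * \<bar>sin r\<bar> + \<bar>\<beta>\<bar> * \<bar>cos r\<bar>"
    by (rule order_trans[OF abs_triangle_ineq]) (simp add: abs_mult)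
  also have "\<dots> \<le> \<bar>\<alpha>\<bar> * 1 + \<bar>\<beta>\<bar> * 1" by (intro add_mono mult_left_mono) auto
  finally show ?thesis by simp
qed

text \<open>At \<open>r = 0\<close> the logarithm oscillates, but the powers of \<open>r\<close> in front of it win. Continuity
there lets the fundamental theorem of calculus start every trajectory at \<open>z\<close>.\<close>

lemma isCont_g_h:
  assumes "r \<ge> 0"
  shows "isCont g1 r" "isCont g2 r" "isCont h1 r" "isCont h2 r"
proof -
  have 0: "isCont g1 0" "isCont g2 0" "isCont h1 0" "isCont h2 0"
  proof -
    show "isCont g1 0"
      by (rule isCont_0_dominated[where C = 1 and n = 3])
        (simp_all add: g1_def abs_mult power_abs mult_left_le)
    show "isCont g2 0"
      by (rule isCont_0_dominated[where C = 1 and n = 3])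
        (simp_all add: g2_def abs_mult power_abs mult_left_le)
    have "\<bar>h1 r\<bar> \<le> 2 * \<bar>r\<bar> ^ 1" for r
      using mult_left_mono[OF abs_cos_sin_combination[of 3 "ln r" 1], of "\<bar>r\<bar>"]
      by (simp add: h1_def abs_mult)
    then show "isCont h1 0"
      by (rule isCont_0_dominated[rotated]) (simp_all add: h1_def)
    have "\<bar>h2 r\<bar> \<le> 2 * \<bar>r\<bar> ^ 1" for r
      using mult_left_mono[OF abs_cos_sin_combination[of "-1" "ln r" 3], of "\<bar>r\<bar>"]
      by (simp add: h2_def abs_mult)
    then show "isCont h2 0"
      by (rule isCont_0_dominated[rotated]) (simp_all add: h2_def)
  qed
  show "isCont g1 r" "isCont g2 r" "isCont h1 r" "isCont h2 r"
    using 0 assms g1_has_derivative[of r] g2_has_derivative[of r] h1_has_derivative[of r]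
      h2_has_derivative[of r]
    by (cases "r = 0"; force intro: DERIV_isCont)+
qed

lemma continuous_on_traj:
  assumes "fst m \<noteq> 0"
  shows "continuous_on {0..} (\<lambda>r. traj r m)"
proof -
  have "continuous_on {0..} g1" "continuous_on {0..} g2" "continuous_on {0..} h1" "continuous_on {0..} h2"
    by (auto intro!: continuous_at_imp_continuous_on isCont_g_h)
  then show ?thesis unfolding traj_def using assms by (intro continuous_intros) auto
qed

lemma kin_mult_traj_0: "kin_mult z (traj 0 m) = z"
  by (simp add: traj_def kin_mult_eq g1_def g2_def h1_def h2_def)

text \<open>The derivative in \<open>r\<close> of the velocity component of a trajectory, equal to \<open>\<F> a r b\<close> for
\<open>r > 0\<close> and Borel jointly in \<open>r\<close> and \<open>m\<close>.\<close>

definition force :: "real \<Rightarrow> 'd::finite point \<Rightarrow> real ^ 'd" where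
  "force r m = ((sin (ln r) + 2 * cos (ln r)) / fst m) *\<^sub>R fst (snd m)
             + (cos (ln r) - 2 * sin (ln r)) *\<^sub>R snd (snd m)"

lemma force_measurable [measurable]:
  assumes [measurable]: "R \<in> borel_measurable M" "m \<in> borel_measurable M"
  shows "(\<lambda>x. force (R x) (m x)) \<in> borel_measurable M"
  unfolding force_def [abs_def] by measurable

lemma \<F>_eq_force: "r > 0 \<Longrightarrow> \<F> (fst m) r (snd m) = force r m"
  by (simp add: force_def \<F>_eq)

lemma force_bounded:
  assumes "m \<in> cyl"
  shows "norm (force r m) \<le> 6"
proof -
  have m: "1 \<le> \<bar>fst m\<bar>" "norm (fst (snd m)) \<le> 1" "norm (snd (snd m)) \<le> 1"
    using assms by (auto simp: cyl_def)
  have "\<bar>sin (ln r) + 2 * cos (ln r)\<bar> / \<bar>fst m\<bar> \<le> 3 / 1"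
    using abs_cos_sin_combination[of 1 "ln r" 2] m(1) by (intro frac_le) auto
  moreover have "\<bar>cos (ln r) - 2 * sin (ln r)\<bar> \<le> 3"
    using abs_cos_sin_combination[of "-2" "ln r" 1] by simp
  ultimately have "\<bar>sin (ln r) + 2 * cos (ln r)\<bar> / \<bar>fst m\<bar> * norm (fst (snd m))
      + \<bar>cos (ln r) - 2 * sin (ln r)\<bar> * norm (snd (snd m)) \<le> 3 / 1 * 1 + 3 * 1"
    by (intro add_mono mult_mono m) auto
  then show ?thesis
    unfolding force_def by (intro order_trans[OF norm_triangle_ineq]) simp
qed

text \<open>The derivative of the \<open>x\<close>-component is the current velocity times the derivative of the
\<open>t\<close>-component: \<open>g1\<close> and \<open>g2\<close> differentiate to \<open>2 r h1\<close> and \<open>2 r h2\<close>, and the shear in the group law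
contributes the velocity of \<open>z\<close>. Along such a curve \<open>f\<close> sees only the transport derivative and \<open>grad_v f\<close>.\<close>

lemma kin_mult_traj_has_derivative:
  assumes r: "r > 0" and m: "fst m \<noteq> 0"
  shows "((\<lambda>r. kin_mult z (traj r m)) has_vector_derivative
    (2 * r * fst m, (2 * r * fst m) *\<^sub>R snd (snd (kin_mult z (traj r m))), force r m)) (at r)"
proof -
  have c: "((\<lambda>r. c r *\<^sub>R w) has_vector_derivative c' *\<^sub>R w) (at r)"
    if "(c has_real_derivative c') (at r)" for c c' and w :: "real ^ 'a"
    using has_vector_derivative_scaleR[OF that has_vector_derivative_const[of w]] by simp
  have 1: "((\<lambda>r. fst z + r\<^sup>2 * fst m) has_vector_derivative 2 * r * fst m) (at r)"
    unfolding has_real_derivative_iff_has_vector_derivative[symmetric]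
    by (auto intro!: derivative_eq_intros)
  have 2: "((\<lambda>r. fst (snd z) + (g1 r *\<^sub>R fst (snd m) + (fst m * g2 r) *\<^sub>R snd (snd m))
        + (r\<^sup>2 * fst m) *\<^sub>R snd (snd z)) has_vector_derivative
      0 + ((2 * r * h1 r) *\<^sub>R fst (snd m) + (fst m * (2 * r * h2 r)) *\<^sub>R snd (snd m))
        + (2 * r * fst m) *\<^sub>R snd (snd z)) (at r)"
    by (intro has_vector_derivative_add has_vector_derivative_const c
        g1_has_derivative[OF r] DERIV_cmult g2_has_derivative[OF r])
      (auto intro!: derivative_eq_intros)
  have 3: "((\<lambda>r. snd (snd z) + ((h1 r / fst m) *\<^sub>R fst (snd m) + h2 r *\<^sub>R snd (snd m)))
      has_vector_derivative 0 + force r m) (at r)"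
    unfolding force_def
    by (intro has_vector_derivative_add has_vector_derivative_const c
        h2_has_derivative[OF r] DERIV_cdivide h1_has_derivative[OF r])
  show ?thesis
    using has_vector_derivative_Pair[OF 1 has_vector_derivative_Pair[OF 2 3]] m
    by (simp add: kin_mult_eq traj_def algebra_simps)
qed

locale kinetic_equation =
  fixes f S1 :: "'d::finite point \<Rightarrow> real" and S0 :: "'d point \<Rightarrow> real ^ 'd"
  assumes f: "schwartz f" and S0: "schwartz S0" and S1: "schwartz S1"
    and eq: "\<And>t x v. partial_t f (t, x, v) + v \<bullet> grad_x f (t, x, v)
                     = div_v S0 (t, x, v) + S1 (t, x, v)"
begin

lemma smooth_f: "smooth f" and smooth_S0: "smooth S0" and smooth_S1: "smooth S1"
  using f S0 S1 by (auto simp: schwartz_def)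

lemma continuous_f: "continuous_on UNIV f"
  by (intro differentiable_borel smooth_differentiable smooth_f)

lemma data_measurable [measurable]:
  "f \<in> borel_measurable borel" "S0 \<in> borel_measurable borel" "S1 \<in> borel_measurable borel"
  "div_v S0 \<in> borel_measurable borel" "grad_v f \<in> borel_measurable borel"
  by (intro differentiable_borel(2) smooth_differentiable smooth_f smooth_S0 smooth_S1
      div_v_measurable S0 borel_measurable_continuous_onI continuous_on_grad_v)+

text \<open>The derivative of \<open>f\<close> along a translated trajectory, with the transport derivative already
replaced by the right-hand side of the equation.\<close>

definition rate :: "'d point \<Rightarrow> real \<Rightarrow> 'd point \<Rightarrow> real" where
  "rate z r m = (2 * r * fst m) * (div_v S0 (kin_mult z (traj r m)) + S1 (kin_mult z (traj r m)))
     + force r m \<bullet> grad_v f (kin_mult z (traj r m))"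

lemma f_along_traj:
  assumes "r > 0" "fst m \<noteq> 0"
  shows "((\<lambda>r. f (kin_mult z (traj r m))) has_vector_derivative rate z r m) (at r)"
proof -
  define p where "p = kin_mult z (traj r m)"
  have dif: "f differentiable (at p)" by (intro smooth_differentiable smooth_f)
  have "dir_deriv (2 * r * fst m, (2 * r * fst m) *\<^sub>R snd (snd p), force r m) f p
      = (2 * r * fst m) * (partial_t f p + snd (snd p) \<bullet> grad_x f p) + force r m \<bullet> grad_v f p"
    unfolding dir_deriv_point[OF dif] by (simp add: distrib_left)
  also have "partial_t f p + snd (snd p) \<bullet> grad_x f p = div_v S0 p + S1 p"
    using eq[of "fst p" "fst (snd p)" "snd (snd p)"] by simp
  also have "(2 * r * fst m) * (div_v S0 p + S1 p) + force r m \<bullet> grad_v f p = rate z r m"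
    by (simp add: rate_def p_def)
  finally have "dir_deriv (2 * r * fst m, (2 * r * fst m) *\<^sub>R snd (snd p), force r m) f p
      = rate z r m" .
  then show ?thesis
    using has_vector_derivative_along[OF dif[unfolded p_def] kin_mult_traj_has_derivative[OF assms]]
    by (simp add: p_def)
qed

lemma rate_measurable [measurable]:
  assumes [measurable]: "R \<in> borel_measurable M" "m \<in> borel_measurable M"
  shows "(\<lambda>x. rate z (R x) (m x)) \<in> borel_measurable M"
  unfolding rate_def [abs_def] by measurable

lemma rate_bounded: "\<exists>B. \<forall>r\<in>{0<..<\<tau>}. \<forall>m\<in>cyl. \<bar>rate z r m\<bar> \<le> B"
proof -
  obtain C0 C1 C2 where C: "\<And>z. \<bar>div_v S0 z\<bar> \<le> C0" "\<And>z. \<bar>S1 z\<bar> \<le> C1" "\<And>z. norm (grad_v f z) \<le> C2"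
    using div_v_bounded[OF S0] schwartz_bounded[OF S1] schwartz_grad_v_bounded[OF f]
    unfolding real_norm_def by metis
  have "\<bar>rate z r m\<bar> \<le> (2 * \<tau> * 2) * (C0 + C1) + 6 * C2" if r: "r \<in> {0<..<\<tau>}" and m: "m \<in> cyl" for r m
  proof -
    define p where "p = kin_mult z (traj r m)"
    have "\<bar>rate z r m\<bar> \<le> \<bar>(2 * r * fst m) * (div_v S0 p + S1 p)\<bar> + \<bar>force r m \<bullet> grad_v f p\<bar>"
      unfolding rate_def p_def by (rule abs_triangle_ineq)
    also have "\<dots> \<le> (2 * r * \<bar>fst m\<bar>) * (\<bar>div_v S0 p\<bar> + \<bar>S1 p\<bar>) + norm (force r m) * norm (grad_v f p)"
      using r by (intro add_mono Cauchy_Schwarz_ineq2)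
        (auto simp: abs_mult intro!: mult_left_mono abs_triangle_ineq)
    also have "\<dots> \<le> (2 * \<tau> * 2) * (C0 + C1) + 6 * C2"
      using r cyl_fst[OF m] by (intro add_mono mult_mono C force_bounded[OF m]) auto
    finally show ?thesis .
  qed
  then show ?thesis by blast
qed

lemma integral_rate:
  assumes \<tau>: "\<tau> > 0" and m: "m \<in> cyl"
  shows "(LINT r|lborel. indicator {0<..<\<tau>} r * rate z r m) = f (kin_mult z (traj \<tau> m)) - f z"
proof -
  have nz: "fst m \<noteq> 0" using m by (auto simp: cyl_def)
  obtain B where B: "\<And>r. r \<in> {0<..<\<tau>} \<Longrightarrow> \<bar>rate z r m\<bar> \<le> B"
    using rate_bounded[of \<tau> z] m by blast
  have "(rate_m has_integral f (kin_mult z (traj \<tau> m)) - f (kin_mult z (traj 0 m))) {0..\<tau>}"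
    if "rate_m = (\<lambda>r. rate z r m)" for rate_m
    unfolding that
  proof (rule fundamental_theorem_of_calculus_interior)
    show "continuous_on {0..\<tau>} (\<lambda>r. f (kin_mult z (traj r m)))"
      by (rule continuous_on_compose2[OF continuous_f])
        (auto intro!: continuous_on_kin_mult continuous_on_subset[OF continuous_on_traj[OF nz]])
    show "((\<lambda>r. f (kin_mult z (traj r m))) has_vector_derivative rate z r m) (at r)"
      if "r \<in> {0<..<\<tau>}" for r
      using that by (intro f_along_traj nz) auto
  qed (use \<tau> in simp)
  then have "((\<lambda>r. rate z r m) has_integral f (kin_mult z (traj \<tau> m)) - f z) {0<..<\<tau>}"
    by (simp add: kin_mult_traj_0 has_integral_Icc_iff_Ioo)
  moreover have "set_integrable lborel {0<..<\<tau>} (\<lambda>r. rate z r m)"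
    unfolding set_integrable_def
    by (rule integrableI_bounded_set[where A = "{0<..<\<tau>}" and B = B]) (use B \<tau> in \<open>auto simp: indicator_def\<close>)
  ultimately show ?thesis
    using set_borel_integral_eq_integral(2)[of "{0<..<\<tau>}" "\<lambda>r. rate z r m"]
    by (simp add: integral_unique set_lebesgue_integral_def)
qed

end

lemma (in profile) K_vec_eq_force:
  assumes "r > 0"
  shows "K_vec \<psi> r = pushed r (\<lambda>m. - \<psi> m *\<^sub>R force r m)"
  unfolding K_vec_eq_pushed[OF assms] \<F>_eq_force[OF assms] ..

lemma (in profile) kin_conv_exists_K_vec:
  assumes r: "r > 0" and [measurable]: "g \<in> borel_measurable borel" and g: "\<And>p. norm (g p) \<le> C"
  shows "kin_conv_exists (K_vec \<psi> r) g z"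
proof -
  obtain B where B: "\<And>m. norm (\<psi> m) \<le> B" using psi_bounded by blast
  have "norm (- \<psi> m *\<^sub>R force r m) \<le> B * 6" if "m \<in> cyl" for m
  proof -
    have "norm (- \<psi> m *\<^sub>R force r m) = norm (\<psi> m) * norm (force r m)" by simp
    also have "\<dots> \<le> B * 6"
      by (intro mult_mono B force_bounded[OF that] norm_ge_zero order_trans[OF norm_ge_zero B])
    finally show ?thesis .
  qed
  then show ?thesis
    unfolding K_vec_eq_force[OF r]
    by (intro kin_conv_exists_pushed[where B = "B * 6" and C = C] r g) (auto simp: psi_outside)
qed

section \<open>The representation formula\<close>

locale representation = profile \<psi> + kinetic_equation f S1 S0
  for \<psi> f S1 :: "'d::finite point \<Rightarrow> real" and S0
begin

lemma kernels_exist: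
  assumes "r > 0"
  shows "kin_conv_exists (K \<psi> r) f z" "kin_conv_exists (K_pi \<psi> r) S0 z"
    "kin_conv_exists (K_tilde \<psi> r) S1 z" "kin_conv_exists (K_tilde \<psi> r) (div_v S0) z"
    "kin_conv_exists (K_vec \<psi> r) (grad_v f) z"
proof -
  obtain C where "\<And>z. norm (f z) \<le> C" using schwartz_bounded[OF f] by blast
  then show "kin_conv_exists (K \<psi> r) f z" by (intro kin_conv_exists_K[where C = C] assms) auto
  obtain C where "\<And>z. norm (S0 z) \<le> C" using schwartz_bounded[OF S0] by blast
  then show "kin_conv_exists (K_pi \<psi> r) S0 z" by (intro kin_conv_exists_K_pi[where C = C] assms) auto
  obtain C where "\<And>z. norm (S1 z) \<le> C" using schwartz_bounded[OF S1] by blast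
  then show "kin_conv_exists (K_tilde \<psi> r) S1 z" by (intro kin_conv_exists_K_tilde[where C = C] assms) auto
  obtain C where "\<And>z. norm (div_v S0 z) \<le> C" using div_v_bounded[OF S0] by blast
  then show "kin_conv_exists (K_tilde \<psi> r) (div_v S0) z"
    by (intro kin_conv_exists_K_tilde[where C = C] assms) auto
  obtain C where "\<And>z. norm (grad_v f z) \<le> C" using schwartz_grad_v_bounded[OF f] by blast
  then show "kin_conv_exists (K_vec \<psi> r) (grad_v f) z"
    by (intro kin_conv_exists_K_vec[where C = C] assms) auto
qed

text \<open>After the divergence has been put back on \<open>S0\<close>, the three kernels have the profiles
\<open>- 2 r a \<psi>\<close>, \<open>- 2 r a \<psi>\<close> and \<open>- \<psi> force\<close>, so the three terms of \<open>rate\<close> appear under one integral.\<close>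

lemma kernel_sum_eq:
  assumes r: "r > 0"
  shows "kin_conv (K_pi \<psi> r) S0 z + kin_conv (K_tilde \<psi> r) S1 z + kin_conv (K_vec \<psi> r) (grad_v f) z
    = - (LINT m|lborel. \<psi> m * rate z r m)"
proof -
  have m1: "(\<lambda>m. - (2 * r * fst m) * \<psi> m) \<in> borel_measurable borel"
    "(\<lambda>m. - \<psi> m *\<^sub>R force r m) \<in> borel_measurable borel" by measurable
  have off: "m \<notin> cyl \<Longrightarrow> - (2 * r * fst m) * \<psi> m = 0" "m \<notin> cyl \<Longrightarrow> - \<psi> m *\<^sub>R force r m = 0" for m
    by (simp_all add: psi_outside)
  note iff1 = kin_conv_exists_pushed_iff[OF r m1(1) _ off(1), folded K_tilde_eq_pushed[OF r]]
  note iff2 = kin_conv_exists_pushed_iff[OF r m1(2) _ off(2), folded K_vec_eq_force[OF r]]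
  note eq1 = kin_conv_pushed[OF r m1(1) _ off(1), folded K_tilde_eq_pushed[OF r]]
  note eq2 = kin_conv_pushed[OF r m1(2) _ off(2), folded K_vec_eq_force[OF r]]
  let ?p = "\<lambda>m. kin_mult z (traj r m)"
  have i: "integrable lborel (\<lambda>m. - (2 * r * fst m) * \<psi> m * div_v S0 (?p m))"
    "integrable lborel (\<lambda>m. - (2 * r * fst m) * \<psi> m * S1 (?p m))"
    "integrable lborel (\<lambda>m. (- \<psi> m *\<^sub>R force r m) \<bullet> grad_v f (?p m))"
    using kernels_exist(3-5)[OF r, of z] iff1[of S1 z] iff1[of "div_v S0" z] iff2[of "grad_v f" z]
    by simp_all
  have "kin_conv (K_pi \<psi> r) S0 z + kin_conv (K_tilde \<psi> r) S1 z + kin_conv (K_vec \<psi> r) (grad_v f) z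
    = (LINT m|lborel. - (2 * r * fst m) * \<psi> m * div_v S0 (?p m))
    + (LINT m|lborel. - (2 * r * fst m) * \<psi> m * S1 (?p m))
    + (LINT m|lborel. (- \<psi> m *\<^sub>R force r m) \<bullet> grad_v f (?p m))"
    unfolding kin_conv_K_pi[OF r S0] using eq1[of S1 z] eq1[of "div_v S0" z] eq2[of "grad_v f" z]
    by simp
  also have "\<dots> = (LINT m|lborel. - (2 * r * fst m) * \<psi> m * div_v S0 (?p m)
      + - (2 * r * fst m) * \<psi> m * S1 (?p m) + (- \<psi> m *\<^sub>R force r m) \<bullet> grad_v f (?p m))"
    using i by (simp only: Bochner_Integration.integral_add Bochner_Integration.integrable_add)
  also have "\<dots> = (LINT m|lborel. - (\<psi> m * rate z r m))"
    by (intro Bochner_Integration.integral_cong refl) (simp add: rate_def algebra_simps)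
  finally show ?thesis by simp
qed

text \<open>Fubini on \<open>{0<..<\<tau>} \<times> cyl\<close>, a set of finite measure on which the integrand is bounded: in
one order the inner integrals are the kernel sums, in the other they are increments of \<open>f\<close> along trajectories.\<close>

lemma representation_formula:
  fixes z :: "'d point"
  assumes \<tau>: "\<tau> > 0" and mass: "(LINT p|lborel. \<psi> p) = 1"
  defines "R \<equiv> \<lambda>r. kin_conv (K_pi \<psi> r) S0 z + kin_conv (K_tilde \<psi> r) S1 z
           + kin_conv (K_vec \<psi> r) (grad_v f) z"
  shows "set_integrable lborel {0<..<\<tau>} R"
    and "f z - kin_conv (K \<psi> \<tau>) f z = (LBINT r:{0<..<\<tau>}. R r)"
proof -
  define F :: "real \<times> 'd point \<Rightarrow> real" where
    "F = (\<lambda>(r, m). indicator {0<..<\<tau>} r * (\<psi> m * rate z r m))"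
  obtain B where B: "\<And>m. norm (\<psi> m) \<le> B" using psi_bounded by blast
  obtain C where C: "\<And>r m. r \<in> {0<..<\<tau>} \<Longrightarrow> m \<in> cyl \<Longrightarrow> \<bar>rate z r m\<bar> \<le> C"
    using rate_bounded[of \<tau> z] by blast
  have "integrable lborel F"
  proof (rule integrableI_bounded_set[where A = "{0<..<\<tau>} \<times> cyl" and B = "B * C"])
    show "{0<..<\<tau>} \<times> cyl \<in> sets (lborel :: (real \<times> 'd point) measure)"
      unfolding cyl_def sets_lborel by (intro borel_open open_Times) auto
    show "emeasure lborel ({0<..<\<tau>} \<times> (cyl :: 'd point set)) < \<infinity>"
      unfolding cyl_def by (intro emeasure_bounded_finite bounded_Times) auto
    show "F \<in> borel_measurable lborel" unfolding F_def case_prod_unfold by measurable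
    have "norm (F q) \<le> B * C" if "q \<in> {0<..<\<tau>} \<times> cyl" for q
    proof -
      have "norm (F q) = norm (\<psi> (snd q)) * \<bar>rate z (fst q) (snd q)\<bar>"
        using that by (auto simp: F_def abs_mult)
      also have "\<dots> \<le> B * C"
        using that by (intro mult_mono B C order_trans[OF norm_ge_zero B]) auto
      finally show ?thesis .
    qed
    then show "AE q in lborel. q \<in> {0<..<\<tau>} \<times> cyl \<longrightarrow> norm (F q) \<le> B * C" by simp
    have "F q = 0" if "q \<notin> {0<..<\<tau>} \<times> cyl" for q
      using that by (auto simp: F_def indicator_def psi_outside mem_Times_iff split: prod.splits)
    then show "AE q in lborel. q \<notin> {0<..<\<tau>} \<times> cyl \<longrightarrow> F q = 0" by simp
  qed
  then have F: "integrable (lborel \<Otimes>\<^sub>M lborel) F" by (simp add: lborel_prod)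
  have R: "indicator {0<..<\<tau>} r *\<^sub>R R r = - (LINT m|lborel. F (r, m))" for r
    using kernel_sum_eq[of r z] by (auto simp: R_def F_def indicator_def)
  show "set_integrable lborel {0<..<\<tau>} R"
    unfolding set_integrable_def R using lborel_pair.integrable_fst'[OF F] by simp
  have slice: "(LINT r|lborel. F (r, m)) = \<psi> m * f (kin_mult z (traj \<tau> m)) - \<psi> m * f z" for m
  proof (cases "m \<in> cyl")
    case True
    have "(LINT r|lborel. F (r, m)) = (LINT r|lborel. \<psi> m * (indicator {0<..<\<tau>} r * rate z r m))"
      by (simp add: F_def mult_ac)
    then show ?thesis by (simp add: integral_rate[OF \<tau> True] right_diff_distrib)
  qed (simp add: F_def psi_outside)
  have K: "kin_conv (K \<psi> \<tau>) f z = (LINT m|lborel. \<psi> m * f (kin_mult z (traj \<tau> m)))"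
    "integrable lborel (\<lambda>m. \<psi> m * f (kin_mult z (traj \<tau> m)))"
    using kernels_exist(1)[OF \<tau>, of z]
      kin_conv_pushed[OF \<tau> psi_measurable data_measurable(1) psi_outside, of z]
      kin_conv_exists_pushed_iff[OF \<tau> psi_measurable data_measurable(1) psi_outside, of z]
    by (simp_all add: K_eq_pushed[OF \<tau>])
  have psi: "integrable lborel \<psi>"
    using mass not_integrable_integral_eq by fastforce
  have "(LBINT r:{0<..<\<tau>}. R r) = - (LINT r|lborel. LINT m|lborel. F (r, m))"
    unfolding set_lebesgue_integral_def R by simp
  also have "(LINT r|lborel. LINT m|lborel. F (r, m)) = (LINT m|lborel. LINT r|lborel. F (r, m))"
    using lborel_pair.Fubini_integral[of "\<lambda>r m. F (r, m)"] F by simp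
  also have "\<dots> = kin_conv (K \<psi> \<tau>) f z - f z"
    unfolding slice K(1) using K(2) psi mass by simp
  finally show "f z - kin_conv (K \<psi> \<tau>) f z = (LBINT r:{0<..<\<tau>}. R r)" by simp
qed

end

theorem mainTheorem3:
  fixes \<psi> f S1 :: "'d::finite point \<Rightarrow> real"
    and S0 :: "'d point \<Rightarrow> real ^ 'd"
    and \<tau> :: real
    and z :: "'d point"
  assumes psi_test: "test_function \<psi>"
    and psi_nonneg: "\<And>p. \<psi> p \<ge> 0"
    and psi_int: "(LINT p|lborel. \<psi> p) = 1"
    and psi_supp: "support \<psi> \<subseteq> {-2<..<-1} \<times> ball 0 1 \<times> ball 0 1"
    and f: "schwartz f" and S0: "schwartz S0" and S1: "schwartz S1"
    and eq: "\<And>t x v. partial_t f (t, x, v) + v \<bullet> grad_x f (t, x, v)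
                     = div_v S0 (t, x, v) + S1 (t, x, v)"
    and tau: "\<tau> > 0"
  shows "kin_conv_exists (K \<psi> \<tau>) f z \<and>
    (\<forall>r\<in>{0<..<\<tau>}. kin_conv_exists (K_pi \<psi> r) S0 z \<and> kin_conv_exists (K_tilde \<psi> r) S1 z
       \<and> kin_conv_exists (K_vec \<psi> r) (grad_v f) z) \<and>
    set_integrable lborel {0<..<\<tau>}
      (\<lambda>r. kin_conv (K_pi \<psi> r) S0 z + kin_conv (K_tilde \<psi> r) S1 z
           + kin_conv (K_vec \<psi> r) (grad_v f) z) \<and>
    f z - kin_conv (K \<psi> \<tau>) f z
      = (LBINT r:{0<..<\<tau>}. kin_conv (K_pi \<psi> r) S0 z + kin_conv (K_tilde \<psi> r) S1 z
           + kin_conv (K_vec \<psi> r) (grad_v f) z)"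
proof -
  interpret representation \<psi> f S1 S0
    using psi_test psi_supp f S0 S1 eq
    by (simp add: representation_def profile_def kinetic_equation_def cyl_def)
  show ?thesis
    using kernels_exist(1)[OF tau] kernels_exist(2,3,5) representation_formula[OF tau psi_int, of z] by auto
qed

end
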